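(* Every computable trivial measure on $2^\omega$ is diminutive.
   Context: All measures are Borel probability measures on Cantor space $2^\omega$. A measure $\mu$ is computable if $\sigma\mapsto\mu(\{X:\sigma\prec X\})$ is a computable real-valued function on finite binary strings. $\mathrm{Atoms}_\mu=\{X:\mu(\{X\})>0\}$; $\mu$ is trivial if $\mu(\mathrm{Atoms}_\mu)=1$. For $\mathcal C\subseteq 2^\omega$ let $\mathrm{Ext}(\mathcal C)=\{\sigma\in 2^{<\omega}:(\exists X\in\mathcal C)\,\sigma\prec X\}$. A nonempty class $\mathcal C\subseteq 2^\omega$ is computably perfect if there is a computable, strictly increasing $f:\omega\to\omega$ such that for each $n$ and each $\sigma\in\mathrm{Ext}(\mathcal C)$ with $|\sigma|=f(n)$ there are incomparable $\tau_1,\tau_2\in\mathrm{Ext}(\mathcal C)$ extending $\sigma$ with $|\tau_1|=|\tau_2|=f(n+1)$. A class $\mathcal C$ is diminutive if it does not contain a computably perfect subclass. A $\mu$-Martin-Löf test is a uniformly $\Sigma^0_1$ sequence $(\mathcal U_i)_{i\in\omega}$ with $\mu(\mathcal U_i)\le 2^{-i}$; it is universal if $\bigcap_i\mathcal U_i$ contains $\bigcap_i\mathcal V_i$ for every $\mu$-Martin-Löf test $(\mathcal V_i)_i$. A computable measure $\mu$ is diminutive if, for a universal $\mu$-Martin-Löf test $(\mathcal U_i)_{i\in\omega}$, the $\Pi^0_1$ class $2^\omega\setminus\mathcal U_i$ is diminutive for every $i$. *)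

theory Defs
  imports "HOL-Probability.Probability_Measure" "HOL-Library.Sublist" "HOL-Library.Nat_Bijection"
begin

section \<open>Computability on the natural numbers\<close>

text \<open>
  The (total) recursive functions of each arity: the least class containing the zero, successor and
  projection functions and closed under composition, primitive recursion and minimization of
  regular functions.  An \<open>n\<close>-ary function is represented by a function on lists, of which only the
  values on lists of length \<open>n\<close> are meaningful.
\<close>

inductive recursive :: "nat \<Rightarrow> (nat list \<Rightarrow> nat) \<Rightarrow> bool" where
  zero: "recursive n (\<lambda>xs. 0)"
| succ: "recursive 1 (\<lambda>xs. Suc (xs ! 0))"
| proj: "i < n \<Longrightarrow> recursive n (\<lambda>xs. xs ! i)"
| comp: "recursive (length hs) g \<Longrightarrow> (\<And>h. h \<in> set hs \<Longrightarrow> recursive n h)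
    \<Longrightarrow> recursive n (\<lambda>xs. g (map (\<lambda>h. h xs) hs))"
| prim_rec: "recursive n g \<Longrightarrow> recursive (n + 2) h
    \<Longrightarrow> recursive (Suc n) (\<lambda>xs. rec_nat (g (tl xs)) (\<lambda>k r. h (k # r # tl xs)) (hd xs))"
| minim: "recursive (Suc n) g \<Longrightarrow> (\<And>xs. length xs = n \<Longrightarrow> \<exists>y. g (y # xs) = 0)
    \<Longrightarrow> recursive n (\<lambda>xs. LEAST y. g (y # xs) = 0)"

definition computable1 :: "(nat \<Rightarrow> nat) \<Rightarrow> bool" where
  "computable1 f \<longleftrightarrow> (\<exists>F. recursive 1 F \<and> (\<forall>x. f x = F [x]))"

definition computable2 :: "(nat \<Rightarrow> nat \<Rightarrow> nat) \<Rightarrow> bool" where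
  "computable2 f \<longleftrightarrow> (\<exists>F. recursive 2 F \<and> (\<forall>x y. f x y = F [x, y]))"

text \<open>A binary relation is computably enumerable if it is the projection of a decidable one.\<close>

definition ce2 :: "(nat \<Rightarrow> nat \<Rightarrow> bool) \<Rightarrow> bool" where
  "ce2 W \<longleftrightarrow> (\<exists>F. recursive 3 F \<and> (\<forall>x y. W x y \<longleftrightarrow> (\<exists>s. F [x, y, s] = 0)))"

definition str_code :: "bool list \<Rightarrow> nat" where
  "str_code \<sigma> = list_encode (map of_bool \<sigma>)"

text \<open>
  A real-valued function on strings is computable if \<open>g \<sigma>\<close> can be approximated by a rational to
  within \<open>(1/2)^n\<close>, computably in \<open>\<sigma>\<close> and \<open>n\<close>; the rationals are
  presented by an integer numerator and a positive denominator.
\<close>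

definition computable_real_fun :: "(bool list \<Rightarrow> real) \<Rightarrow> bool" where
  "computable_real_fun g \<longleftrightarrow> (\<exists>p q. computable2 p \<and> computable2 q \<and>
     (\<forall>\<sigma> n. \<bar>g \<sigma> - of_int (int_decode (p (str_code \<sigma>) n)) / real (Suc (q (str_code \<sigma>) n))\<bar>
        \<le> (1/2) ^ n))"

section \<open>Cantor space\<close>

text \<open>The topology and the Borel sets on this type are those of the product topology.\<close>

type_synonym cantor = "nat \<Rightarrow> bool"

definition initial_segment :: "bool list \<Rightarrow> cantor \<Rightarrow> bool" (infix "\<prec>" 50) where
  "\<sigma> \<prec> X \<longleftrightarrow> (\<forall>i < length \<sigma>. \<sigma> ! i = X i)"

definition cylinder :: "bool list \<Rightarrow> cantor set" where
  "cylinder \<sigma> = {X. \<sigma> \<prec> X}"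

definition Ext :: "cantor set \<Rightarrow> bool list set" where
  "Ext C = {\<sigma>. \<exists>X\<in>C. \<sigma> \<prec> X}"

text \<open>\<open>\<parallel>\<close> is incomparability of strings.\<close>

definition computably_perfect :: "cantor set \<Rightarrow> bool" where
  "computably_perfect C \<longleftrightarrow> C \<noteq> {} \<and>
     (\<exists>f. computable1 f \<and> strict_mono f \<and>
       (\<forall>n. \<forall>\<sigma>\<in>Ext C. length \<sigma> = f n \<longrightarrow>
         (\<exists>\<tau>1\<in>Ext C. \<exists>\<tau>2\<in>Ext C. prefix \<sigma> \<tau>1 \<and> prefix \<sigma> \<tau>2 \<and> \<tau>1 \<parallel> \<tau>2 \<and>
            length \<tau>1 = f (n + 1) \<and> length \<tau>2 = f (n + 1))))"

definition diminutive :: "cantor set \<Rightarrow> bool" where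
  "diminutive C \<longleftrightarrow> \<not> (\<exists>D. D \<subseteq> C \<and> computably_perfect D)"

section \<open>Measures on Cantor space\<close>

definition computable_measure :: "cantor measure \<Rightarrow> bool" where
  "computable_measure \<mu> \<longleftrightarrow> computable_real_fun (\<lambda>\<sigma>. measure \<mu> (cylinder \<sigma>))"

definition Atoms :: "cantor measure \<Rightarrow> cantor set" where
  "Atoms \<mu> = {X. measure \<mu> {X} > 0}"

definition trivial_measure :: "cantor measure \<Rightarrow> bool" where
  "trivial_measure \<mu> \<longleftrightarrow> measure \<mu> (Atoms \<mu>) = 1"

definition uniformly_Sigma01 :: "(nat \<Rightarrow> cantor set) \<Rightarrow> bool" where
  "uniformly_Sigma01 U \<longleftrightarrow>
     (\<exists>W. ce2 W \<and> (\<forall>i. U i = (\<Union>\<sigma>\<in>{\<sigma>. W i (str_code \<sigma>)}. cylinder \<sigma>)))"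

definition martin_loef_test :: "cantor measure \<Rightarrow> (nat \<Rightarrow> cantor set) \<Rightarrow> bool" where
  "martin_loef_test \<mu> U \<longleftrightarrow> uniformly_Sigma01 U \<and> (\<forall>i. measure \<mu> (U i) \<le> (1/2) ^ i)"

definition universal_martin_loef_test :: "cantor measure \<Rightarrow> (nat \<Rightarrow> cantor set) \<Rightarrow> bool" where
  "universal_martin_loef_test \<mu> U \<longleftrightarrow> martin_loef_test \<mu> U \<and> (\<forall>V. martin_loef_test \<mu> V \<longrightarrow> (\<Inter>i. V i) \<subseteq> (\<Inter>i. U i))"

text \<open>
  The condition does not depend on the choice of the universal test (by a Baire category argument
  inside the closure of a computably perfect class); the definition asks for it for some universal
  test, so that it also asserts that there is one.
\<close>

definition diminutive_measure :: "cantor measure \<Rightarrow> bool" where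
  "diminutive_measure \<mu> \<longleftrightarrow> (\<exists>U. universal_martin_loef_test \<mu> U \<and> (\<forall>i. diminutive (- U i)))"

end

theory Submission
  imports Defs
begin

text \<open>
  Let \<open>U\<close> be a universal \<open>\<mu>\<close>-Martin-Loef test and suppose that the complement of some \<open>U i\<close>
  contains a class \<open>D\<close> that is computably perfect, with splitting levels given by \<open>f\<close>.  Above each
  string of length \<open>f n\<close> that is extendible in \<open>D\<close> there are two incomparable extendible strings of
  length \<open>f (n + 1)\<close>, and one of them has at most half the measure of the given one.  Always passing
  to the lighter one yields a sequence \<open>X\<close> in the closure of \<open>D\<close> whose prefix of length \<open>f n\<close> has
  measure at most \<open>2\<^sup>-\<^sup>n\<close> for every \<open>n\<close> (\<open>light_path_in_closure\<close>).  The complement of \<open>U i\<close> is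
  closed, so \<open>X\<close> still avoids \<open>U i\<close>.

  On the other hand, the set of all such light sequences is an effectively closed set that contains
  no atom, so it is null because \<open>\<mu>\<close> is trivial.  Computable approximations of \<open>\<mu>\<close> yield clopen
  sets, each covering all light sequences, whose measures tend to \<open>0\<close> and can be computed to any
  precision; hence one can search effectively for a set in this family of measure at most
  \<open>2\<^sup>-\<^sup>k\<close>, and the sets found form a Martin-Loef test that catches \<open>X\<close> (\<open>light_path_caught\<close>).  By universality \<open>X\<close> lies in \<open>U i\<close>, a contradiction.

  It remains to know that a universal test exists (\<open>universal_martin_loef_test_exists\<close>).  The
  classical argument enumerates all uniformly c.e. families of open sets, stops the enumeration of
  each member before its measure becomes too large, and takes unions along shifted levels.  It rests on
  a universal c.e. relation (\<open>universal_ce_enumerates\<close>), which is obtained from an abstract machine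
  whose states are natural numbers: one machine step is a computable function, and every recursive
  function is compiled into a program of the machine.

  Both the trimming and the search compare measures of clopen sets with bounds.  As such a
  comparison of reals is undecidable, it is replaced by a decidable test whose answer is allowed to be
  arbitrary inside a gap (\<open>decide_small_measure\<close>).
\<close>

section \<open>Closure properties of the computable functions\<close>

text \<open>
  Computability of a concrete function is derived syntactically.  All parameters of a term are packed
  by the pairing function into one number \<open>e\<close>, and the rules collected below as
  \<open>computability_intros\<close> follow the structure of the term, a bound variable being added as a further
  component of \<open>e\<close>.  Recursion needs step functions of three arguments, whence the ternary notion.
\<close>

definition computable3 :: "(nat \<Rightarrow> nat \<Rightarrow> nat \<Rightarrow> nat) \<Rightarrow> bool" where
  "computable3 f \<longleftrightarrow> (\<exists>F. recursive 3 F \<and> (\<forall>x y z. f x y z = F [x, y, z]))"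

text \<open>
  The class \<open>recursive\<close> contains functions on lists as such, not up to equality on lists of the right
  length.  The lemmas that follow pass to the curried notions, for which extensional equality suffices.
\<close>

lemma recursive_comp1:
  "recursive 1 g \<Longrightarrow> recursive n a \<Longrightarrow> recursive n (\<lambda>xs. g [a xs])"
  using comp[of "[a]" g n] by simp

lemma recursive_comp2:
  "recursive 2 g \<Longrightarrow> recursive n a \<Longrightarrow> recursive n b \<Longrightarrow> recursive n (\<lambda>xs. g [a xs, b xs])"
  using comp[of "[a, b]" g n] by (auto simp: numeral_2_eq_2)

lemma recursive_comp3:
  "recursive 3 g \<Longrightarrow> recursive n a \<Longrightarrow> recursive n b \<Longrightarrow> recursive n c \<Longrightarrow>
    recursive n (\<lambda>xs. g [a xs, b xs, c xs])"
  using comp[of "[a, b, c]" g n] by (auto simp: numeral_3_eq_3)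

lemma computable1_id: "computable1 (\<lambda>x. x)"
  unfolding computable1_def by (rule exI[of _ "\<lambda>xs. xs ! 0"]) (use recursive.proj in simp)

lemma computable1_Suc_bare: "computable1 Suc"
  unfolding computable1_def
  by (rule exI[of _ "\<lambda>xs. Suc (xs ! 0)"]) (use recursive.succ in simp)

lemma computable1_comp:
  assumes "computable1 f" "computable1 a"
  shows "computable1 (\<lambda>x. f (a x))"
proof -
  obtain F where F: "recursive 1 F" "\<And>x. f x = F [x]"
    using assms(1) unfolding computable1_def by blast
  obtain A where A: "recursive 1 A" "\<And>x. a x = A [x]"
    using assms(2) unfolding computable1_def by blast
  show ?thesis unfolding computable1_def
    using recursive_comp1[OF F(1) A(1)] F(2) A(2)
    by (intro exI[of _ "\<lambda>xs. F [A xs]"]) simp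
qed

lemma computable1_Suc: "computable1 a \<Longrightarrow> computable1 (\<lambda>x. Suc (a x))"
  by (rule computable1_comp[OF computable1_Suc_bare])

lemma computable1_comp2:
  assumes "computable2 f" "computable1 a" "computable1 b"
  shows "computable1 (\<lambda>x. f (a x) (b x))"
proof -
  obtain F where F: "recursive 2 F" "\<And>x y. f x y = F [x, y]"
    using assms(1) unfolding computable2_def by blast
  obtain A where A: "recursive 1 A" "\<And>x. a x = A [x]"
    using assms(2) unfolding computable1_def by blast
  obtain B where B: "recursive 1 B" "\<And>x. b x = B [x]"
    using assms(3) unfolding computable1_def by blast
  show ?thesis unfolding computable1_def
    using recursive_comp2[OF F(1) A(1) B(1)] F(2) A(2) B(2)
    by (intro exI[of _ "\<lambda>xs. F [A xs, B xs]"]) simp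
qed

lemma computable1_comp3:
  assumes "computable3 f" "computable1 a" "computable1 b" "computable1 c"
  shows "computable1 (\<lambda>x. f (a x) (b x) (c x))"
proof -
  obtain F where F: "recursive 3 F" "\<And>x y z. f x y z = F [x, y, z]"
    using assms(1) unfolding computable3_def by blast
  obtain A where A: "recursive 1 A" "\<And>x. a x = A [x]"
    using assms(2) unfolding computable1_def by blast
  obtain B where B: "recursive 1 B" "\<And>x. b x = B [x]"
    using assms(3) unfolding computable1_def by blast
  obtain C where C: "recursive 1 C" "\<And>x. c x = C [x]"
    using assms(4) unfolding computable1_def by blast
  show ?thesis unfolding computable1_def
    using recursive_comp3[OF F(1) A(1) B(1) C(1)] F(2) A(2) B(2) C(2)
    by (intro exI[of _ "\<lambda>xs. F [A xs, B xs, C xs]"]) simp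
qed

lemma computable2_comp1:
  assumes "computable1 f" "computable2 a"
  shows "computable2 (\<lambda>x y. f (a x y))"
proof -
  obtain F where F: "recursive 1 F" "\<And>x. f x = F [x]"
    using assms(1) unfolding computable1_def by blast
  obtain A where A: "recursive 2 A" "\<And>x y. a x y = A [x, y]"
    using assms(2) unfolding computable2_def by blast
  show ?thesis unfolding computable2_def
    using recursive_comp1[OF F(1) A(1)] F(2) A(2)
    by (intro exI[of _ "\<lambda>xs. F [A xs]"]) simp
qed

lemma computable2_comp2:
  assumes "computable2 f" "computable2 a" "computable2 b"
  shows "computable2 (\<lambda>x y. f (a x y) (b x y))"
proof -
  obtain F where F: "recursive 2 F" "\<And>x y. f x y = F [x, y]"
    using assms(1) unfolding computable2_def by blast
  obtain A where A: "recursive 2 A" "\<And>x y. a x y = A [x, y]"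
    using assms(2) unfolding computable2_def by blast
  obtain B where B: "recursive 2 B" "\<And>x y. b x y = B [x, y]"
    using assms(3) unfolding computable2_def by blast
  show ?thesis unfolding computable2_def
    using recursive_comp2[OF F(1) A(1) B(1)] F(2) A(2) B(2)
    by (intro exI[of _ "\<lambda>xs. F [A xs, B xs]"]) simp
qed

lemma computable3_comp1:
  assumes "computable1 f" "computable3 a"
  shows "computable3 (\<lambda>x y z. f (a x y z))"
proof -
  obtain F where F: "recursive 1 F" "\<And>x. f x = F [x]"
    using assms(1) unfolding computable1_def by blast
  obtain A where A: "recursive 3 A" "\<And>x y z. a x y z = A [x, y, z]"
    using assms(2) unfolding computable3_def by blast
  show ?thesis unfolding computable3_def
    using recursive_comp1[OF F(1) A(1)] F(2) A(2)
    by (intro exI[of _ "\<lambda>xs. F [A xs]"]) simp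
qed

lemma computable3_comp2:
  assumes "computable2 f" "computable3 a" "computable3 b"
  shows "computable3 (\<lambda>x y z. f (a x y z) (b x y z))"
proof -
  obtain F where F: "recursive 2 F" "\<And>x y. f x y = F [x, y]"
    using assms(1) unfolding computable2_def by blast
  obtain A where A: "recursive 3 A" "\<And>x y z. a x y z = A [x, y, z]"
    using assms(2) unfolding computable3_def by blast
  obtain B where B: "recursive 3 B" "\<And>x y z. b x y z = B [x, y, z]"
    using assms(3) unfolding computable3_def by blast
  show ?thesis unfolding computable3_def
    using recursive_comp2[OF F(1) A(1) B(1)] F(2) A(2) B(2)
    by (intro exI[of _ "\<lambda>xs. F [A xs, B xs]"]) simp
qed

lemma computable2_fst: "computable2 (\<lambda>x y. x)"
  unfolding computable2_def by (rule exI[of _ "\<lambda>xs. xs ! 0"]) (use recursive.proj in simp)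

lemma computable2_snd: "computable2 (\<lambda>x y. y)"
  unfolding computable2_def by (rule exI[of _ "\<lambda>xs. xs ! 1"]) (use recursive.proj in simp)

lemma computable3_proj:
  "computable3 (\<lambda>x y z. x)" "computable3 (\<lambda>x y z. y)" "computable3 (\<lambda>x y z. z)"
proof -
  have "\<exists>F. recursive 3 F \<and> (\<forall>x y z. [x, y, z] ! i = F [x, y, z])" if "i < 3" for i
    using recursive.proj[OF that] by (intro exI[of _ "\<lambda>xs. xs ! i"]) simp
  from this[of 0] this[of 1] this[of 2]
  show "computable3 (\<lambda>x y z. x)" "computable3 (\<lambda>x y z. y)" "computable3 (\<lambda>x y z. z)"
    unfolding computable3_def by simp_all
qed

lemma computable1_const: "computable1 (\<lambda>x. k)"
proof (induction k)
  case 0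
  show ?case unfolding computable1_def
    by (rule exI[of _ "\<lambda>xs. 0"]) (simp add: recursive.zero)
next
  case (Suc k)
  then show ?case by (rule computable1_Suc)
qed

lemma computable2_rec:
  assumes "computable1 g" "computable3 h"
  shows "computable2 (\<lambda>x y. rec_nat (g y) (\<lambda>k r. h k r y) x)"
proof -
  obtain G H where G: "recursive 1 G" "\<And>y. g y = G [y]"
    and H: "recursive 3 H" "\<And>k r y. h k r y = H [k, r, y]"
    using assms unfolding computable1_def computable3_def by blast
  have "recursive (Suc 1) (\<lambda>xs. rec_nat (G (tl xs)) (\<lambda>k r. H (k # r # tl xs)) (hd xs))"
    using prim_rec[of 1 G H] G H by (simp add: numeral_3_eq_3 numeral_2_eq_2)
  then show ?thesis unfolding computable2_def using G H by (auto simp: numeral_2_eq_2)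
qed

lemma computable1_minimization:
  assumes "computable2 g" "\<And>x. \<exists>y. g y x = 0"
  shows "computable1 (\<lambda>x. LEAST y. g y x = 0)"
proof -
  obtain G where G: "recursive 2 G" "\<And>y x. g y x = G [y, x]"
    using assms unfolding computable2_def by blast
  have "\<exists>y. G (y # xs) = 0" if "length xs = 1" for xs
    using that assms(2) G(2) by (cases xs) auto
  then have "recursive 1 (\<lambda>xs. LEAST y. G (y # xs) = 0)"
    using minim[of 1 G] G(1) by (simp add: numeral_2_eq_2)
  then show ?thesis unfolding computable1_def using G by auto
qed

lemma computable2_add: "computable2 (\<lambda>x y. x + y)"
proof -
  have "(\<lambda>x y. x + y) = (\<lambda>x y. rec_nat y (\<lambda>k r. Suc r) x)"
  proof (intro ext)
    show "x + y = rec_nat y (\<lambda>k r. Suc r) x" for x y by (induction x) auto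
  qed
  then show ?thesis
    by (simp only:) (intro computable2_rec computable1_id
        computable3_comp1[OF computable1_Suc_bare] computable3_proj)
qed

lemma computable1_pred: "computable1 (\<lambda>x. x - 1)"
proof -
  have "(\<lambda>x. x - 1) = (\<lambda>x. rec_nat 0 (\<lambda>k r. k) x)"
  proof (intro ext)
    show "x - 1 = rec_nat 0 (\<lambda>k r. k) x" for x :: nat by (cases x) auto
  qed
  moreover have "computable2 (\<lambda>x y :: nat. rec_nat 0 (\<lambda>k r. k) x)"
    by (intro computable2_rec computable1_const computable3_proj)
  ultimately show ?thesis
    using computable1_comp2[OF _ computable1_id computable1_id] by simp
qed

lemma computable2_diff: "computable2 (\<lambda>x y. x - y)"
proof -
  have "(\<lambda>x y. y - x) = (\<lambda>x y. rec_nat y (\<lambda>k r. r - 1) x)"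
  proof (intro ext)
    show "y - x = rec_nat y (\<lambda>k r. r - 1) x" for x y :: nat by (induction x) auto
  qed
  then have "computable2 (\<lambda>x y. y - x)"
    by (simp only:) (intro computable2_rec computable1_id
        computable3_comp1[OF computable1_pred] computable3_proj)
  from computable2_comp2[OF this computable2_snd computable2_fst] show ?thesis by simp
qed

lemma computable1_triangle: "computable1 triangle"
proof -
  have "triangle x = rec_nat 0 (\<lambda>k r. r + Suc k) x" for x
    by (induction x) auto
  then have "triangle = (\<lambda>x. rec_nat 0 (\<lambda>k r. r + Suc k) x)" by auto
  moreover have "computable2 (\<lambda>x y :: nat. rec_nat 0 (\<lambda>k r. r + Suc k) x)"
    by (intro computable2_rec computable1_const computable3_comp2[OF computable2_add]
        computable3_comp1[OF computable1_Suc_bare] computable3_proj)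
  ultimately show ?thesis
    using computable1_comp2[OF _ computable1_id computable1_id] by simp
qed

abbreviation pr :: "nat \<Rightarrow> nat \<Rightarrow> nat" where
  "pr a b \<equiv> prod_encode (a, b)"

abbreviation pfst :: "nat \<Rightarrow> nat" where
  "pfst e \<equiv> fst (prod_decode e)"

abbreviation psnd :: "nat \<Rightarrow> nat" where
  "psnd e \<equiv> snd (prod_decode e)"

lemma computable2_pr: "computable2 pr"
  unfolding prod_encode_def case_prod_conv
  by (intro computable2_comp2[OF computable2_add] computable2_comp1[OF computable1_triangle]
      computable2_fst computable2_snd)

lemma triangle_mono: "m \<le> n \<Longrightarrow> triangle m \<le> triangle n"
  by (induction rule: dec_induct) auto

lemma triangle_diagonal: "triangle (pfst z + psnd z) + pfst z = z"
proof -
  have "prod_encode (prod_decode z) = triangle (pfst z + psnd z) + pfst z"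
    unfolding prod_encode_def split_beta by (rule refl)
  then show ?thesis by simp
qed

text \<open>
  Since \<open>z = triangle (m + n) + m\<close> is the code of the pair \<open>(m, n)\<close>, the sum \<open>m + n\<close> is the index of the
  largest triangular number not above \<open>z\<close>, so it can be found by a search; the components follow from it.
\<close>

lemma computable1_diagonal: "computable1 (\<lambda>z. pfst z + psnd z)"
proof -
  have eq: "(LEAST s. Suc z - triangle (Suc s) = 0) = pfst z + psnd z" for z
  proof (rule Least_equality)
    show "Suc z - triangle (Suc (pfst z + psnd z)) = 0"
      using triangle_diagonal[of z] by simp
    show "pfst z + psnd z \<le> s" if "Suc z - triangle (Suc s) = 0" for s
    proof (rule ccontr)
      assume "\<not> ?thesis"
      then have "triangle (Suc s) \<le> triangle (pfst z + psnd z)" by (intro triangle_mono) simp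
      then show False using that triangle_diagonal[of z] by linarith
    qed
  qed
  have ex: "\<exists>s. Suc z - triangle (Suc s) = 0" for z
  proof -
    have "z \<le> triangle z" by (induction z) auto
    then show ?thesis by (intro exI[of _ z]) simp
  qed
  have "computable1 (\<lambda>z. LEAST s. Suc z - triangle (Suc s) = 0)"
    by (intro computable1_minimization ex computable2_comp2[OF computable2_diff]
        computable2_comp1[OF computable1_Suc_bare] computable2_comp1[OF computable1_triangle]
        computable2_fst computable2_snd)
  then show ?thesis unfolding eq .
qed

lemma computable1_pfst_bare: "computable1 pfst"
proof -
  have "pfst z = z - triangle (pfst z + psnd z)" for z
    using triangle_diagonal[of z] by linarith
  moreover have "computable1 (\<lambda>z. z - triangle (pfst z + psnd z))"
    by (intro computable1_comp2[OF computable2_diff] computable1_id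
        computable1_comp[OF computable1_triangle] computable1_diagonal)
  ultimately show ?thesis by presburger
qed

lemma computable1_psnd_bare: "computable1 psnd"
proof -
  have "computable1 (\<lambda>z. (pfst z + psnd z) - pfst z)"
    by (intro computable1_comp2[OF computable2_diff] computable1_diagonal computable1_pfst_bare)
  then show ?thesis by simp
qed

lemmas computable1_pr = computable1_comp2[OF computable2_pr]
lemmas computable1_pfst = computable1_comp[OF computable1_pfst_bare]
lemmas computable1_psnd = computable1_comp[OF computable1_psnd_bare]
lemmas computable1_add = computable1_comp2[OF computable2_add]
lemmas computable1_diff = computable1_comp2[OF computable2_diff]

lemma computable2_iff: "computable2 f \<longleftrightarrow> computable1 (\<lambda>e. f (pfst e) (psnd e))"
proof
  show "computable1 (\<lambda>e. f (pfst e) (psnd e))" if "computable2 f"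
    by (intro computable1_comp2[OF that] computable1_pfst_bare computable1_psnd_bare)
  assume "computable1 (\<lambda>e. f (pfst e) (psnd e))"
  from computable2_comp1[OF this computable2_pr] show "computable2 f" by simp
qed

lemma computable3_iff:
  "computable3 f \<longleftrightarrow> computable1 (\<lambda>e. f (pfst e) (pfst (psnd e)) (psnd (psnd e)))"
proof
  show "computable1 (\<lambda>e. f (pfst e) (pfst (psnd e)) (psnd (psnd e)))" if "computable3 f"
    by (intro computable1_comp3[OF that] computable1_pfst computable1_psnd computable1_id)
  assume "computable1 (\<lambda>e. f (pfst e) (pfst (psnd e)) (psnd (psnd e)))"
  from computable3_comp1[OF this computable3_comp2[OF computable2_pr computable3_proj(1)
        computable3_comp2[OF computable2_pr computable3_proj(2,3)]]]
  show "computable3 f" by simp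
qed

text \<open>
  The recursion may use the environment \<open>e\<close> also in the step function; a triple carries \<open>e\<close>, the
  counter and the previous value.
\<close>

lemma computable1_rec:
  assumes "computable1 n" "computable1 g"
    and "computable1 (\<lambda>e. h (pfst e) (pfst (psnd e)) (psnd (psnd e)))"
  shows "computable1 (\<lambda>e. rec_nat (g e) (\<lambda>k r. h e k r) (n e))"
proof -
  have "computable3 (\<lambda>k r e. h e k r)"
    using computable3_comp1[OF assms(3) computable3_comp2[OF computable2_pr computable3_proj(3)
        computable3_comp2[OF computable2_pr computable3_proj(1,2)]]] by simp
  from computable1_comp2[OF computable2_rec[OF assms(2) this] assms(1) computable1_id]
  show ?thesis .
qed

lemma computable1_mult: 
  assumes "computable1 a" "computable1 b"
  shows "computable1 (\<lambda>e. a e * b e)"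
proof -
  have "x * y = rec_nat 0 (\<lambda>k r. r + y) x" for x y :: nat
    by (induction x) auto
  moreover have "computable1 (\<lambda>e. rec_nat 0 (\<lambda>k r. r + b e) (a e))"
    by (intro computable1_rec assms computable1_const computable1_add computable1_pfst
        computable1_psnd computable1_id computable1_comp[OF assms(2)])
  ultimately show ?thesis by simp
qed

lemma computable1_power: 
  assumes "computable1 a" "computable1 b"
  shows "computable1 (\<lambda>e. a e ^ b e)"
proof -
  have "x ^ y = rec_nat 1 (\<lambda>k r. r * x) y" for x y :: nat
    by (induction y) auto
  moreover have "computable1 (\<lambda>e. rec_nat 1 (\<lambda>k r. r * a e) (b e))"
    by (intro computable1_rec assms computable1_const computable1_mult computable1_pfst
        computable1_psnd computable1_id computable1_comp[OF assms(1)])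
  ultimately show ?thesis by simp
qed

subsection \<open>Decidable predicates\<close>

definition decidable :: "(nat \<Rightarrow> bool) \<Rightarrow> bool" where
  "decidable P \<longleftrightarrow> computable1 (\<lambda>e. of_bool (P e))"

lemma decidable_comp: "decidable P \<Longrightarrow> computable1 a \<Longrightarrow> decidable (\<lambda>e. P (a e))"
  unfolding decidable_def by (rule computable1_comp)

text \<open>
  The case distinction is turned into arithmetic with the two characteristic functions.
\<close>

lemma computable1_if:
  assumes "decidable P" "computable1 a" "computable1 b"
  shows "computable1 (\<lambda>e. if P e then a e else b e)"
proof -
  have "(if P e then a e else b e) = of_bool (P e) * a e + (1 - of_bool (P e)) * b e" for e
    by auto
  moreover have "computable1 (\<lambda>e. of_bool (P e) * a e + (1 - of_bool (P e)) * b e)"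
    by (intro computable1_add computable1_mult computable1_diff computable1_const assms
        assms(1)[unfolded decidable_def])
  ultimately show ?thesis by presburger
qed

lemma decidable_le:
  assumes "computable1 a" "computable1 b"
  shows "decidable (\<lambda>e. a e \<le> b e)"
proof -
  have "of_bool (a e \<le> b e) = 1 - (a e - b e)" for e by auto
  then show ?thesis unfolding decidable_def
    by (simp only:) (intro computable1_diff computable1_const assms)
qed

lemma decidable_not: "decidable P \<Longrightarrow> decidable (\<lambda>e. \<not> P e)"
proof -
  assume "decidable P"
  moreover have "of_bool (\<not> P e) = 1 - (of_bool (P e) :: nat)" for e by auto
  ultimately show ?thesis unfolding decidable_def
    by (simp only:) (intro computable1_diff computable1_const)
qed

lemma decidable_conj: "decidable P \<Longrightarrow> decidable Q \<Longrightarrow> decidable (\<lambda>e. P e \<and> Q e)"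
  unfolding decidable_def of_bool_conj by (rule computable1_mult)

lemma decidable_disj:
  assumes "decidable P" "decidable Q" shows "decidable (\<lambda>e. P e \<or> Q e)"
proof -
  have "(\<lambda>e. P e \<or> Q e) = (\<lambda>e. \<not> (\<not> P e \<and> \<not> Q e))" by auto
  then show ?thesis
    by (simp only:) (intro decidable_not decidable_conj assms)
qed

lemma decidable_less:
  "computable1 a \<Longrightarrow> computable1 b \<Longrightarrow> decidable (\<lambda>e. a e < b e)"
  unfolding not_le[symmetric] by (intro decidable_not decidable_le)

lemma decidable_eq:
  "computable1 a \<Longrightarrow> computable1 b \<Longrightarrow> decidable (\<lambda>e. a e = b e)"
  unfolding order_eq_iff by (intro decidable_conj decidable_le)

lemma computable1_sum:
  assumes "computable1 n" and "computable1 (\<lambda>e. f (pfst e) (psnd e))"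
  shows "computable1 (\<lambda>e. \<Sum>k<n e. f e k)"
proof -
  have "(\<Sum>k<n. f e k) = rec_nat 0 (\<lambda>k r. r + f e k) n" for e n
    by (induction n) auto
  moreover have "computable1 (\<lambda>e. f (pfst e) (pfst (psnd e)))"
    using computable1_comp[OF assms(2), of "\<lambda>e. pr (pfst e) (pfst (psnd e))"]
    by (simp add: computable1_pr computable1_pfst computable1_psnd computable1_id)
  then have "computable1 (\<lambda>e. rec_nat 0 (\<lambda>k r. r + f e k) (n e))"
    by (intro computable1_rec assms computable1_const computable1_add computable1_pfst
        computable1_psnd computable1_id)
  ultimately show ?thesis by presburger
qed

lemma decidable_bex:
  assumes "computable1 n" and "decidable (\<lambda>e. P (pfst e) (psnd e))"
  shows "decidable (\<lambda>e. \<exists>k<n e. P e k)"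
proof -
  \<comment> \<open>a bounded search is a finite sum of characteristic values\<close>
  have "(\<lambda>e. \<exists>k<n e. P e k) = (\<lambda>e. 0 < (\<Sum>k<n e. of_bool (P e k) :: nat))"
    by (intro ext) (auto simp: sum_pos2 not_less simp flip: neq0_conv)
  then show ?thesis
    by (simp only:) (intro decidable_less computable1_const computable1_sum assms
        assms(2)[unfolded decidable_def])
qed

lemma computable1_Least:
  assumes "decidable (\<lambda>e. P (pfst e) (psnd e))" and "\<And>e. \<exists>k. P e k"
  shows "computable1 (\<lambda>e. LEAST k. P e k)"
proof -
  have "computable2 (\<lambda>k e. of_bool (\<not> P e k))"
    using decidable_comp[OF decidable_not[OF assms(1)]
        computable1_pr[OF computable1_psnd_bare computable1_pfst_bare]]
    unfolding computable2_iff decidable_def by simp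
  from computable1_minimization[OF this] show ?thesis using assms(2) by simp
qed

lemma computable1_div:
  assumes "computable1 a" "computable1 b"
  shows "computable1 (\<lambda>e. a e div b e)"
proof -
  have eq: "(LEAST q. y = 0 \<or> x < Suc q * y) = x div y" for x y :: nat
  proof (cases "y = 0")
    case False
    show ?thesis
    proof (rule Least_equality)
      show "y = 0 \<or> x < Suc (x div y) * y"
        using False dividend_less_div_times[of y x] by simp
      show "x div y \<le> q" if "y = 0 \<or> x < Suc q * y" for q
        using that False by (metis less_mult_imp_div_less less_Suc_eq_le)
    qed
  qed (simp add: Least_equality)
  have "computable1 (\<lambda>e. LEAST q. b e = 0 \<or> a e < Suc q * b e)"
  proof (rule computable1_Least)
    show "decidable (\<lambda>e. b (pfst e) = 0 \<or> a (pfst e) < Suc (psnd e) * b (pfst e))"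
      by (intro decidable_disj decidable_eq decidable_less computable1_mult computable1_Suc
          computable1_const computable1_comp[OF assms(1)] computable1_comp[OF assms(2)]
          computable1_pfst_bare computable1_psnd_bare)
    show "\<exists>q. b e = 0 \<or> a e < Suc q * b e" for e
      by (rule exI[of _ "a e"]) (cases "b e", auto)
  qed
  then show ?thesis unfolding eq .
qed

lemma decidable_even:
  assumes "computable1 a" shows "decidable (\<lambda>e. even (a e))"
proof -
  have "even x \<longleftrightarrow> x = 2 * (x div 2)" for x :: nat by presburger
  then show ?thesis
    by (simp only:) (intro decidable_eq computable1_mult computable1_div computable1_const assms)
qed

lemmas computability_intros = computable1_id computable1_const computable1_Suc computable1_pr
  computable1_pfst computable1_psnd computable1_add computable1_diff computable1_mult
  computable1_power computable1_div computable1_if computable1_rec computable1_sum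
  decidable_le decidable_less decidable_eq decidable_conj decidable_disj decidable_not
  decidable_bex decidable_even

text \<open>
  The definition of \<open>ce2\<close> asks for a zero of a recursive function, so the witness relation has to be
  negated before taking its characteristic function.
\<close>

lemma ce2I:
  assumes "decidable (\<lambda>e. P (pfst e) (pfst (psnd e)) (psnd (psnd e)))"
  shows "ce2 (\<lambda>x y. \<exists>s. P x y s)"
proof -
  have "computable3 (\<lambda>x y s. of_bool (\<not> P x y s))"
    using decidable_not[OF assms] unfolding computable3_iff decidable_def .
  then obtain F where "recursive 3 F" "\<And>x y s. of_bool (\<not> P x y s) = F [x, y, s]"
    unfolding computable3_def by blast
  then show ?thesis unfolding ce2_def
    by (intro exI[of _ F]) (auto simp flip: \<open>\<And>x y s. of_bool (\<not> P x y s) = F [x, y, s]\<close>)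
qed

section \<open>A universal computably enumerable relation\<close>

text \<open>
  The machine has a state \<open>pr k v\<close>, where \<open>v\<close> is the current value and \<open>k\<close> codes the stack of
  instructions still to be executed; \<open>0\<close> is the empty stack, which means that the machine has
  halted.  An instruction \<open>pr c a\<close> consists of an operation code \<open>c\<close> and an argument \<open>a\<close>:

    \<^item> \<open>0\<close>, \<open>1\<close>, \<open>2\<close>, \<open>3\<close>, \<open>4\<close>: replace the value by zero, its successor, its predecessor, its first
      component, its second component;
    \<^item> \<open>5\<close>, argument \<open>pr p q\<close>: execute \<open>q\<close> and then \<open>p\<close>;
    \<^item> \<open>6\<close>, argument \<open>pr p q\<close>: pair the results of \<open>p\<close> and \<open>q\<close> on the current value.  This schedules
      \<open>7\<close>, which keeps the original value for \<open>q\<close> while \<open>p\<close> runs, and then \<open>8\<close>, which keeps the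
      result of \<open>p\<close> while \<open>q\<close> runs;
    \<^item> \<open>9\<close>, argument \<open>p\<close>: repeat \<open>p\<close> as long as the first component of the value is not zero.

  Instructions are thus themselves structured programs, and no separate syntax of programs is needed.
\<close>

definition push :: "nat \<Rightarrow> nat \<Rightarrow> nat" where
  "push p k = Suc (pr p k)"

definition step :: "nat \<Rightarrow> nat" where
  "step s = (let K = pfst s; v = psnd s; p = pfst (K - 1); k = psnd (K - 1); c = pfst p; a = psnd p in
     if K = 0 then s
     else if c = 0 then pr k 0
     else if c = 1 then pr k (Suc v)
     else if c = 2 then pr k (v - 1)
     else if c = 3 then pr k (pfst v)
     else if c = 4 then pr k (psnd v)
     else if c = 5 then pr (push (psnd a) (push (pfst a) k)) v
     else if c = 6 then pr (push (pfst a) (push (pr 7 (pr (psnd a) v)) k)) v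
     else if c = 7 then pr (push (pfst a) (push (pr 8 v) k)) (psnd a)
     else if c = 8 then pr k (pr a v)
     else if pfst v = 0 then pr k v
     else pr (push a K) v)"

lemma computable1_step: "computable1 step"
  unfolding step_def Let_def push_def by (intro computability_intros)

definition reaches :: "nat \<Rightarrow> nat \<Rightarrow> bool" where
  "reaches s s' \<longleftrightarrow> (\<exists>t. (step ^^ t) s = s')"

lemma reaches_refl: "reaches s s"
  unfolding reaches_def by (rule exI[of _ 0]) simp

lemma reaches_trans [trans]: "reaches s s' \<Longrightarrow> reaches s' s'' \<Longrightarrow> reaches s s''"
  unfolding reaches_def by (metis comp_apply funpow_add)

lemma reaches_step: "step s = s' \<Longrightarrow> reaches s s'"
  unfolding reaches_def by (rule exI[of _ 1]) simp

text \<open>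
  Quantifying over the remaining stack \<open>k\<close> makes this big-step relation compositional.
\<close>

definition runs :: "nat \<Rightarrow> nat \<Rightarrow> nat \<Rightarrow> bool" where
  "runs p v w \<longleftrightarrow> (\<forall>k. reaches (pr (push p k) v) (pr k w))"

lemma runs_zero: "runs (pr 0 0) v 0"
  and runs_Suc: "runs (pr 1 0) v (Suc v)"
  and runs_pred: "runs (pr 2 0) v (v - 1)"
  and runs_pfst: "runs (pr 3 0) v (pfst v)"
  and runs_psnd: "runs (pr 4 0) v (psnd v)"
  unfolding runs_def by (auto intro!: reaches_step simp: step_def push_def)

lemma runs_comp:
  assumes "runs q u v" "runs p v w" shows "runs (pr 5 (pr p q)) u w"
  unfolding runs_def
proof
  fix k
  have "reaches (pr (push (pr 5 (pr p q)) k) u) (pr (push q (push p k)) u)"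
    by (rule reaches_step) (simp add: step_def push_def)
  also have "reaches (pr (push q (push p k)) u) (pr (push p k) v)"
    using assms(1) by (simp add: runs_def)
  also have "reaches (pr (push p k) v) (pr k w)"
    using assms(2) by (simp add: runs_def)
  finally show "reaches (pr (push (pr 5 (pr p q)) k) u) (pr k w)" .
qed

lemma runs_pair:
  assumes "runs p u v" "runs q u w" shows "runs (pr 6 (pr p q)) u (pr v w)"
  unfolding runs_def
proof
  fix k
  have "reaches (pr (push (pr 6 (pr p q)) k) u) (pr (push p (push (pr 7 (pr q u)) k)) u)"
    by (rule reaches_step) (simp add: step_def push_def)
  also have "reaches (pr (push p (push (pr 7 (pr q u)) k)) u) (pr (push (pr 7 (pr q u)) k) v)"
    using assms(1) by (simp add: runs_def)
  also have "reaches (pr (push (pr 7 (pr q u)) k) v) (pr (push q (push (pr 8 v) k)) u)"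
    by (rule reaches_step) (simp add: step_def push_def)
  also have "reaches (pr (push q (push (pr 8 v) k)) u) (pr (push (pr 8 v) k) w)"
    using assms(2) by (simp add: runs_def)
  also have "reaches (pr (push (pr 8 v) k) w) (pr k (pr v w))"
    by (rule reaches_step) (simp add: step_def push_def)
  finally show "reaches (pr (push (pr 6 (pr p q)) k) u) (pr k (pr v w))" .
qed

lemma runs_while:
  assumes "\<And>i. i < n \<Longrightarrow> pfst (f i) \<noteq> 0" "\<And>i. i < n \<Longrightarrow> runs b (f i) (f (Suc i))"
    and "pfst (f n) = 0"
  shows "runs (pr 9 b) (f 0) (f n)"
  unfolding runs_def
proof
  fix k
  let ?K = "push (pr 9 b) k"
  have "reaches (pr ?K (f 0)) (pr ?K (f i))" if "i \<le> n" for i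
    using that
  proof (induction i)
    case 0
    show ?case by (rule reaches_refl)
  next
    case (Suc i)
    then have "reaches (pr ?K (f 0)) (pr ?K (f i))" by simp
    also have "reaches (pr ?K (f i)) (pr (push b ?K) (f i))"
      by (rule reaches_step) (use assms(1)[of i] Suc in \<open>simp add: step_def push_def\<close>)
    also have "reaches (pr (push b ?K) (f i)) (pr ?K (f (Suc i)))"
      using assms(2)[of i] Suc by (simp add: runs_def)
    finally show ?case .
  qed
  from this[of n] have "reaches (pr ?K (f 0)) (pr ?K (f n))" by simp
  also have "reaches (pr ?K (f n)) (pr k (f n))"
    by (rule reaches_step) (use assms(3) in \<open>simp add: step_def push_def\<close>)
  finally show "reaches (pr ?K (f 0)) (pr k (f n))" .
qed

primrec enc :: "nat list \<Rightarrow> nat" where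
  "enc [] = 0"
| "enc (x # xs) = pr x (enc xs)"

text \<open>
  Induction on the construction of the recursive function.  Composition evaluates its inner functions
  into a coded argument list; primitive recursion is a loop on \<open>(remaining rounds, k, r, parameters)\<close>,
  whose last three components are just the coded argument list of the step function; minimization is
  a loop on \<open>(g (y # xs), y, xs)\<close>, which stops when the first component vanishes.
\<close>

lemma program_for_recursive:
  "recursive n F \<Longrightarrow> \<exists>p. \<forall>xs. length xs = n \<longrightarrow> runs p (enc xs) (F xs)"
proof (induction rule: recursive.induct)
  case (zero n)
  show ?case using runs_zero by blast
next
  case succ
  have "runs (pr 5 (pr (pr 1 0) (pr 3 0))) (enc xs) (Suc (xs ! 0))" if "length xs = 1" for xs
    using that runs_comp[OF runs_pfst runs_Suc] by (cases xs) (auto, metis fst_conv prod_encode_inverse)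
  then show ?case by blast
next
  case (proj i n)
  then show ?case
  proof (induction i arbitrary: n)
    case 0
    have "runs (pr 3 0) (enc xs) (xs ! 0)" if "length xs = n" for xs
      using that 0 runs_pfst[of "enc xs"] by (cases xs) auto
    then show ?case by blast
  next
    case (Suc i)
    then obtain m where m: "n = Suc m" "i < m" by (cases n) auto
    from Suc.IH[OF m(2)] obtain p where p: "\<And>xs. length xs = m \<Longrightarrow> runs p (enc xs) (xs ! i)"
      by blast
    have "runs (pr 5 (pr p (pr 4 0))) (enc xs) (xs ! Suc i)" if "length xs = n" for xs
    proof -
      obtain y ys where xs: "xs = y # ys" "length ys = m"
        using \<open>length xs = n\<close> m by (cases xs) auto
      show ?thesis using runs_comp[OF runs_psnd[of "enc xs"]] p[OF xs(2)] xs by simp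
    qed
    then show ?case by blast
  qed
next
  case (comp hs g n)
  from comp.IH(1) obtain pg where
    pg: "\<And>xs. length xs = length hs \<Longrightarrow> runs pg (enc xs) (g xs)" by blast
  have "\<exists>p. \<forall>xs. length xs = n \<longrightarrow> runs p (enc xs) (enc (map (\<lambda>h. h xs) hs))"
    using comp.IH(2)
  proof (induction hs)
    case Nil
    show ?case using runs_zero by auto
  next
    case (Cons h hs)
    from Cons.prems obtain p where p: "\<And>xs. length xs = n \<Longrightarrow> runs p (enc xs) (h xs)"
      by (metis list.set_intros(1))
    from Cons obtain q where
      q: "\<And>xs. length xs = n \<Longrightarrow> runs q (enc xs) (enc (map (\<lambda>h. h xs) hs))"
      by (metis list.set_intros(2))
    show ?case using runs_pair[OF p q] by auto
  qed
  then obtain q where q: "\<And>xs. length xs = n \<Longrightarrow> runs q (enc xs) (enc (map (\<lambda>h. h xs) hs))"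
    by blast
  have "runs (pr 5 (pr pg q)) (enc xs) (g (map (\<lambda>h. h xs) hs))" if "length xs = n" for xs
    using runs_comp[OF q[OF that] pg] by simp
  then show ?case by blast
next
  case (prim_rec n g h)
  from prim_rec.IH obtain pg ph where
    pg: "\<And>xs. length xs = n \<Longrightarrow> runs pg (enc xs) (g xs)" and
    ph: "\<And>xs. length xs = n + 2 \<Longrightarrow> runs ph (enc xs) (h xs)" by blast
  \<comment> \<open>opaque names for composition and pairing, so that the rules apply by the shape of the program\<close>
  define cmp where "cmp p q = pr 5 (pr p q)" for p q
  define par where "par p q = pr 6 (pr p q)" for p q
  define body where "body = par (cmp (pr 2 0) (pr 3 0))
     (par (cmp (pr 1 0) (cmp (pr 3 0) (pr 4 0)))
       (par (cmp ph (pr 4 0)) (cmp (pr 4 0) (cmp (pr 4 0) (pr 4 0)))))"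
  define init where "init = par (pr 3 0) (par (pr 0 0) (par (cmp pg (pr 4 0)) (pr 4 0)))"
  define prog where "prog = cmp (cmp (pr 3 0) (cmp (pr 4 0) (pr 4 0))) (cmp (pr 9 body) init)"
  note r = runs_comp[folded cmp_def] runs_pair[folded par_def]
    runs_zero runs_Suc runs_pred runs_pfst runs_psnd
  have "runs prog (enc xs) (rec_nat (g (tl xs)) (\<lambda>k r. h (k # r # tl xs)) (hd xs))"
    if "length xs = Suc n" for xs
  proof -
    obtain x ys where xs: "xs = x # ys" "length ys = n"
      using \<open>length xs = Suc n\<close> by (cases xs) auto
    define R where "R = rec_nat (g ys) (\<lambda>k r. h (k # r # ys))"
    define f where "f i = pr (x - i) (pr i (pr (R i) (enc ys)))" for i
    have cpg: "runs (cmp pg (pr 4 0)) (enc xs) (g ys)"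
      using r(1)[OF runs_psnd[of "enc xs"]] pg[OF xs(2)] xs(1) by simp
    have "runs init (enc xs) (pr (pfst (enc xs)) (pr 0 (pr (g ys) (psnd (enc xs)))))"
      unfolding init_def by (rule cpg r)+
    then have 1: "runs init (enc xs) (f 0)" by (simp add: xs(1) f_def R_def)
    have body: "runs body (f i) (f (Suc i))" for i
    proof -
      have cph: "runs (cmp ph (pr 4 0)) (f i) (R (Suc i))"
        using r(1)[OF runs_psnd[of "f i"]] ph[of "i # R i # ys"] xs(2) by (simp add: f_def R_def)
      have "runs body (f i) (pr (pfst (f i) - 1) (pr (Suc (pfst (psnd (f i))))
          (pr (R (Suc i)) (psnd (psnd (psnd (f i)))))))"
        unfolding body_def by (rule cph r)+
      then show ?thesis by (simp add: f_def)
    qed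
    have 2: "runs (pr 9 body) (f 0) (f x)"
      by (rule runs_while) (use body in \<open>auto simp: f_def\<close>)
    have "runs prog (enc xs) (pfst (psnd (psnd (f x))))"
      unfolding prog_def by (rule r 1 2)+
    then show ?thesis by (simp add: f_def R_def xs(1))
  qed
  then show ?case by blast
next
  case (minim n g)
  from minim.IH obtain pg where
    pg: "\<And>xs. length xs = Suc n \<Longrightarrow> runs pg (enc xs) (g xs)" by blast
  define cmp where "cmp p q = pr 5 (pr p q)" for p q
  define par where "par p q = pr 6 (pr p q)" for p q
  define test where "test = par pg (par (pr 3 0) (pr 4 0))"
  define body where "body = cmp test
     (par (cmp (pr 1 0) (cmp (pr 3 0) (pr 4 0))) (cmp (pr 4 0) (pr 4 0)))"
  define init where "init = cmp test (par (pr 0 0) (par (pr 3 0) (pr 4 0)))"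
  define prog where "prog = cmp (cmp (pr 3 0) (pr 4 0)) (cmp (pr 9 body) init)"
  note r = runs_comp[folded cmp_def] runs_pair[folded par_def]
    runs_zero runs_Suc runs_pred runs_pfst runs_psnd
  have "runs prog (enc xs) (LEAST y. g (y # xs) = 0)" if "length xs = n" for xs
  proof -
    define f where "f i = pr (g (i # xs)) (pr i (enc xs))" for i
    have test: "runs test (pr i (enc xs)) (f i)" for i
    proof -
      have "runs test (pr i (enc xs)) (pr (g (i # xs))
          (pr (pfst (pr i (enc xs))) (psnd (pr i (enc xs)))))"
        unfolding test_def by (rule r | use pg[of "i # xs"] that in simp)+
      then show ?thesis by (simp add: f_def)
    qed
    have "runs (par (pr 0 0) (par (pr 3 0) (pr 4 0))) (enc xs)
        (pr 0 (pr (pfst (enc xs)) (psnd (enc xs))))" by (rule r)+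
    then have "runs (par (pr 0 0) (par (pr 3 0) (pr 4 0))) (enc xs) (pr 0 (enc xs))" by simp
    then have 1: "runs init (enc xs) (f 0)"
      unfolding init_def using test[of 0] by (rule r)
    have body: "runs body (f i) (f (Suc i))" for i
    proof -
      have "runs (par (cmp (pr 1 0) (cmp (pr 3 0) (pr 4 0))) (cmp (pr 4 0) (pr 4 0))) (f i)
          (pr (Suc (pfst (psnd (f i)))) (psnd (psnd (f i))))" by (rule r)+
      then have "runs (par (cmp (pr 1 0) (cmp (pr 3 0) (pr 4 0))) (cmp (pr 4 0) (pr 4 0))) (f i)
          (pr (Suc i) (enc xs))" by (simp add: f_def)
      then show ?thesis unfolding body_def using test[of "Suc i"] by (rule r)
    qed
    let ?m = "LEAST y. g (y # xs) = 0"
    have "g (?m # xs) = 0" using LeastI_ex[OF minim.hyps(2)[OF that]] .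
    then have 2: "runs (pr 9 body) (f 0) (f ?m)"
      by (intro runs_while body) (auto simp: f_def dest: not_less_Least)
    have "runs prog (enc xs) (pfst (psnd (f ?m)))"
      unfolding prog_def by (rule r 1 2)+
    then show ?thesis by (simp add: f_def)
  qed
  then show ?case by blast
qed

text \<open>
  The witness \<open>z\<close> packs a candidate \<open>s\<close> for the existentially quantified third argument and a running
  time.  The state \<open>0 = pr 0 0\<close> is the halted state with output \<open>0\<close>.
\<close>

definition universal_ce :: "nat \<Rightarrow> nat \<Rightarrow> nat \<Rightarrow> nat \<Rightarrow> bool" where
  "universal_ce e x y z \<longleftrightarrow> (step ^^ psnd z) (pr (push e 0) (enc [x, y, pfst z])) = 0"

lemma decidable_universal_ce:
  assumes "computable1 a" "computable1 b" "computable1 c" "computable1 d"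
  shows "decidable (\<lambda>e. universal_ce (a e) (b e) (c e) (d e))"
proof -
  have iter: "(step ^^ t) s = rec_nat s (\<lambda>k r. step r) t" for t s
    by (induction t) auto
  show ?thesis unfolding universal_ce_def iter push_def enc.simps
    by (intro computability_intros computable1_comp[OF computable1_step] assms)
qed

text \<open>
  A halted state is a fixed point of \<open>step\<close>, so two runs that halt can be continued to a common time.
\<close>

lemma halting_state_unique:
  assumes "reaches s (pr 0 v)" "reaches s (pr 0 w)" shows "v = w"
proof -
  have fixed: "(step ^^ t) (pr 0 u) = pr 0 u" for t u
    by (induction t) (simp_all add: step_def)
  obtain t t' where t: "(step ^^ t) s = pr 0 v" "(step ^^ t') s = pr 0 w"
    using assms unfolding reaches_def by blast
  have "(step ^^ (t' + t)) s = pr 0 v" "(step ^^ (t + t')) s = pr 0 w"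
    by (simp_all only: funpow_add comp_apply t fixed)
  then show ?thesis by (simp add: add.commute)
qed

theorem universal_ce_enumerates:
  assumes "ce2 W"
  obtains e where "\<And>x y. W x y \<longleftrightarrow> (\<exists>z. universal_ce e x y z)"
proof -
  obtain F where F: "recursive 3 F" "\<And>x y. W x y \<longleftrightarrow> (\<exists>s. F [x, y, s] = 0)"
    using assms unfolding ce2_def by blast
  from program_for_recursive[OF F(1)] obtain e where
    "\<And>xs. length xs = 3 \<Longrightarrow> runs e (enc xs) (F xs)" by blast
  from this[of "[x, y, s]" for x y s] have "runs e (enc [x, y, s]) (F [x, y, s])" for x y s
    by simp
  then have e: "reaches (pr (push e 0) (enc [x, y, s])) (pr 0 (F [x, y, s]))" for x y s
    unfolding runs_def by blast
  have zero: "pr 0 0 = 0" by (simp add: prod_encode_def)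
  have "F [x, y, s] = 0 \<longleftrightarrow> (\<exists>t. (step ^^ t) (pr (push e 0) (enc [x, y, s])) = 0)" for x y s
    using e[of x y s] halting_state_unique[OF e[of x y s], of 0] zero
    unfolding reaches_def by metis
  then have "(\<exists>s. F [x, y, s] = 0) \<longleftrightarrow> (\<exists>z. universal_ce e x y z)" for x y
    unfolding universal_ce_def by (metis prod_encode_inverse fst_conv snd_conv)
  then show ?thesis by (intro that[of e]) (simp only: F(2))
qed

section \<open>Binary strings and clopen sets\<close>

text \<open>
  The strings of length \<open>L\<close> are indexed by the numbers below \<open>2 ^ L\<close>, least significant bit
  first.  The index of a string is then also an index of each of its prefixes, of which only the length
  changes (\<open>take_word\<close>), and sums over all strings of a given length are sums over an initial segment.
\<close>

definition word :: "nat \<Rightarrow> nat \<Rightarrow> bool list" where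
  "word t L = map (bit t) [0..<L]"

lemma length_word [simp]: "length (word t L) = L"
  by (simp add: word_def)

lemma take_word: "j \<le> L \<Longrightarrow> take j (word t L) = word t j"
  by (simp add: word_def take_map)

lemma word_surj: "\<exists>t<2 ^ length \<sigma>. word t (length \<sigma>) = \<sigma>"
proof (intro exI conjI)
  show "horner_sum of_bool 2 \<sigma> < (2 :: nat) ^ length \<sigma>"
    by (rule horner_sum_of_bool_2_less)
  show "word (horner_sum of_bool 2 \<sigma>) (length \<sigma>) = \<sigma>"
    by (rule nth_equalityI) (simp_all add: word_def bit_horner_sum_bit_iff)
qed

lemma word_inj:
  assumes "s < 2 ^ L" "t < 2 ^ L" "word s L = word t L" shows "s = t"
proof -
  have "take_bit L s = take_bit L t"
    using assms(3) unfolding word_def horner_sum_bit_eq_take_bit[symmetric] by (simp only:)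
  then show ?thesis using assms(1,2) by (simp add: take_bit_nat_eq_self)
qed

lemma inj_str_code: "inj str_code"
proof (rule injI)
  fix \<sigma> \<tau> assume "str_code \<sigma> = str_code \<tau>"
  then have "map of_bool \<sigma> = (map of_bool \<tau> :: nat list)"
    unfolding str_code_def by (metis list_encode_inverse)
  moreover have "inj (of_bool :: bool \<Rightarrow> nat)" by (rule injI) (auto simp: of_bool_def split: if_splits)
  ultimately show "\<sigma> = \<tau>" by (simp add: inj_map_eq_map)
qed

lemma computable1_str_code_word:
  assumes "computable1 t" "computable1 L"
  shows "computable1 (\<lambda>e. str_code (word (t e) (L e)))"
proof -
  \<comment> \<open>the code of the last \<open>k\<close> letters, built from the end of the string\<close>
  define c where
    "c t L k = rec_nat 0 (\<lambda>k r. Suc (pr (if even (t div 2 ^ (L - Suc k)) then 0 else 1) r)) k"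
    for t L k :: nat
  have "c t L k = str_code (map (bit t) [L - k..<L])" if "k \<le> L" for t L k
    using that
  proof (induction k)
    case 0
    show ?case by (simp add: c_def str_code_def)
  next
    case (Suc k)
    have "[L - Suc k..<L] = (L - Suc k) # [L - k..<L]"
      using Suc.prems by (simp add: upt_conv_Cons Suc_diff_Suc)
    then show ?case using Suc by (simp add: c_def str_code_def bit_iff_odd)
  qed
  from this[of L L t for t L] have "str_code (word t L) = c t L L" for t L
    by (simp add: word_def)
  then show ?thesis unfolding c_def
    by (simp only:) (intro computability_intros computable1_comp[OF assms(1)]
        computable1_comp[OF assms(2)] assms)
qed

definition init :: "cantor \<Rightarrow> nat \<Rightarrow> bool list" where
  "init X n = map X [0..<n]"

lemma length_init [simp]: "length (init X n) = n"
  by (simp add: init_def)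

lemma take_init: "j \<le> n \<Longrightarrow> take j (init X n) = init X j"
  by (simp add: init_def take_map)

lemma initial_segment_iff: "\<sigma> \<prec> X \<longleftrightarrow> init X (length \<sigma>) = \<sigma>"
proof -
  have "init X (length \<sigma>) = \<sigma> \<longleftrightarrow> (\<forall>i<length \<sigma>. X i = \<sigma> ! i)"
    unfolding list_eq_iff_nth_eq by (simp add: init_def)
  then show ?thesis unfolding initial_segment_def by metis
qed

lemma mem_cylinder_iff: "X \<in> cylinder \<sigma> \<longleftrightarrow> init X (length \<sigma>) = \<sigma>"
  by (simp add: cylinder_def initial_segment_iff)

lemma open_cylinder: "open (cylinder \<sigma>)"
proof -
  have "cylinder \<sigma> = (\<Inter>i\<in>{..<length \<sigma>}. (\<lambda>X. X i) -` {\<sigma> ! i})"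
    by (auto simp: cylinder_def initial_segment_def)
  also have "open \<dots>"
    by (intro open_INT ballI open_vimage finite_lessThan) (auto simp: open_discrete)
  finally show ?thesis .
qed

text \<open>
  Only indices below \<open>2 ^ L\<close> are used, so that distinct indices give disjoint cylinders and measures
  are plain sums (\<open>measure_clopen_set\<close>).
\<close>

definition clopen_set :: "nat \<Rightarrow> (nat \<Rightarrow> bool) \<Rightarrow> cantor set" where
  "clopen_set L Q = (\<Union>t\<in>{t. t < 2 ^ L \<and> Q t}. cylinder (word t L))"

lemma mem_clopen_set_iff:
  "X \<in> clopen_set L Q \<longleftrightarrow> (\<exists>t<2 ^ L. Q t \<and> word t L = init X L)"
  by (auto simp: clopen_set_def mem_cylinder_iff)

lemma open_clopen_set: "open (clopen_set L Q)"
  unfolding clopen_set_def by (intro open_UN ballI open_cylinder)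

lemma measure_clopen_set:
  fixes \<mu> :: "cantor measure"
  assumes "prob_space \<mu>" "sets \<mu> = sets borel"
  shows "measure \<mu> (clopen_set L Q) =
    (\<Sum>t<2 ^ L. of_bool (Q t) * measure \<mu> (cylinder (word t L)))"
proof -
  interpret prob_space \<mu> by fact
  let ?T = "{t. t < 2 ^ L \<and> Q t}"
  have "disjoint_family_on (\<lambda>t. cylinder (word t L)) ?T"
    by (auto simp: disjoint_family_on_def mem_cylinder_iff dest: word_inj)
  then have "measure \<mu> (clopen_set L Q) = (\<Sum>t\<in>?T. measure \<mu> (cylinder (word t L)))"
    unfolding clopen_set_def
    by (intro finite_measure_finite_Union) (auto simp: assms(2) open_cylinder)
  also have "\<dots> = (\<Sum>t<2 ^ L. of_bool (Q t) * measure \<mu> (cylinder (word t L)))"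
    by (rule sum.mono_neutral_cong_left) auto
  finally show ?thesis .
qed

section \<open>Approximating a computable measure\<close>

text \<open>
  Natural numbers close to \<open>2 ^ n * g \<sigma>\<close> are easier to add and compare than fractions.  Negative numerators are raised to \<open>0\<close>, which does not increase the error, and the
  rounding adds at most \<open>1\<close> to the given error.
\<close>

lemma natural_approximation:
  assumes "computable_real_fun g" "\<And>\<sigma>. 0 \<le> g \<sigma>"
  obtains m where "computable2 m" "\<And>\<sigma> n. \<bar>2 ^ n * g \<sigma> - real (m (str_code \<sigma>) n)\<bar> \<le> 2"
proof -
  obtain p q where pq: "computable2 p" "computable2 q" and
    approx: "\<And>\<sigma> n. \<bar>g \<sigma> - of_int (int_decode (p (str_code \<sigma>) n)) / real (Suc (q (str_code \<sigma>) n))\<bar>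
      \<le> (1/2) ^ n"
    using assms(1) unfolding computable_real_fun_def by blast
  define N where "N c n = (if even (p c n) then p c n div 2 else 0)" for c n
  define m where "m c n = (2 ^ n * N c n) div Suc (q c n)" for c n
  have N: "real (N c n) = max 0 (of_int (int_decode (p c n)))" for c n
    by (simp add: N_def int_decode_def sum_decode_def)
  have "computable2 m"
    unfolding computable2_iff m_def N_def
    by (intro computability_intros computable1_comp2[OF pq(1)] computable1_comp2[OF pq(2)])
  moreover have "\<bar>2 ^ n * g \<sigma> - real (m (str_code \<sigma>) n)\<bar> \<le> 2" for \<sigma> n
  proof -
    let ?c = "str_code \<sigma>"
    let ?d = "real (Suc (q ?c n))"
    let ?z = "of_int (int_decode (p ?c n)) :: real"
    have "max 0 ?z / ?d = max 0 (?z / ?d)" by (auto simp: max_def divide_simps)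
    then have "\<bar>g \<sigma> - max 0 ?z / ?d\<bar> \<le> (1/2) ^ n"
      using approx[of \<sigma> n] assms(2)[of \<sigma>] by (simp add: max_def split: if_splits)
    then have "2 ^ n * \<bar>g \<sigma> - max 0 ?z / ?d\<bar> \<le> 2 ^ n * (1/2) ^ n"
      by (intro mult_left_mono) auto
    also have "2 ^ n * (1/2) ^ n = (1 :: real)" by (simp flip: power_mult_distrib)
    also have "2 ^ n * \<bar>g \<sigma> - max 0 ?z / ?d\<bar> = \<bar>2 ^ n * (g \<sigma> - max 0 ?z / ?d)\<bar>"
      by (simp add: abs_mult)
    also have "\<dots> = \<bar>2 ^ n * g \<sigma> - 2 ^ n * max 0 ?z / ?d\<bar>"
      by (simp only: right_diff_distrib times_divide_eq_right)
    finally have 1: "\<bar>2 ^ n * g \<sigma> - 2 ^ n * max 0 ?z / ?d\<bar> \<le> 1" .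
    have "real (m ?c n) = of_int \<lfloor>real (2 ^ n * N ?c n) / ?d\<rfloor>"
      unfolding m_def floor_divide_of_nat_eq by simp
    then have "real (m ?c n) \<le> real (2 ^ n * N ?c n) / ?d" "real (2 ^ n * N ?c n) / ?d < real (m ?c n) + 1"
      by linarith+
    then have 2: "real (m ?c n) \<le> 2 ^ n * max 0 ?z / ?d" "2 ^ n * max 0 ?z / ?d < real (m ?c n) + 1"
      by (simp_all only: of_nat_mult of_nat_power of_nat_numeral N)
    show ?thesis using 1 2 by linarith
  qed
  ultimately show ?thesis by (rule that)
qed

text \<open>
  The measure of a clopen set of level \<open>L a\<close> is a sum of \<open>2 ^ L a\<close> measures of cylinders.  Taking each
  of them with \<open>L a\<close> extra bits of precision leaves an error of \<open>2\<close> after scaling by \<open>2 ^ j\<close>, so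
  comparing the approximation with \<open>4\<close> answers correctly below \<open>2\<close> and above \<open>6\<close>.
\<close>

lemma decide_small_measure:
  fixes \<mu> :: "cantor measure"
  assumes \<mu>: "prob_space \<mu>" "sets \<mu> = sets borel" "computable_measure \<mu>"
    and L: "computable1 L" and Q: "decidable (\<lambda>e. Q (pfst e) (psnd e))"
  obtains small where "decidable (\<lambda>e. small (pfst e) (psnd e))"
    and "\<And>a j. 2 ^ j * measure \<mu> (clopen_set (L a) (Q a)) \<le> 2 \<Longrightarrow> small a j"
    and "\<And>a j. small a j \<Longrightarrow> 2 ^ j * measure \<mu> (clopen_set (L a) (Q a)) \<le> 6"
proof -
  obtain m where m: "computable2 m"
    "\<And>\<sigma> n. \<bar>2 ^ n * measure \<mu> (cylinder \<sigma>) - real (m (str_code \<sigma>) n)\<bar> \<le> 2"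
    using natural_approximation[OF \<mu>(3)[unfolded computable_measure_def]] by (metis measure_nonneg)
  define A where "A a j = (\<Sum>t<2 ^ L a. if Q a t then m (str_code (word t (L a))) (j + L a) else 0)"
    for a j
  have error: "\<bar>2 ^ L a * (2 ^ j * measure \<mu> (clopen_set (L a) (Q a))) - real (A a j)\<bar> \<le> 2 ^ L a * 2"
    for a j
  proof -
    let ?g = "\<lambda>t. if Q a t then 2 ^ (j + L a) * measure \<mu> (cylinder (word t (L a)))
      - real (m (str_code (word t (L a))) (j + L a)) else 0"
    have eq: "2 ^ L a * (2 ^ j * measure \<mu> (clopen_set (L a) (Q a))) - real (A a j) = (\<Sum>t<2 ^ L a. ?g t)"
      unfolding measure_clopen_set[OF \<mu>(1,2)] A_def of_nat_sum sum_distrib_left sum_subtractf[symmetric]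
      by (intro sum.cong) (auto simp: power_add)
    have "\<bar>\<Sum>t<2 ^ L a. ?g t\<bar> \<le> (\<Sum>t<2 ^ L a. \<bar>?g t\<bar>)" by (rule sum_abs)
    also have "\<dots> \<le> (\<Sum>t<(2::nat) ^ L a. 2)" by (intro sum_mono) (use m(2) in auto)
    finally show ?thesis unfolding eq by simp
  qed
  have "decidable (\<lambda>e. A (pfst e) (psnd e) \<le> 2 ^ L (pfst e) * 4)"
    unfolding A_def
    by (intro computability_intros computable1_comp2[OF m(1)] computable1_str_code_word
        computable1_comp[OF L] decidable_comp[OF Q, of "\<lambda>e. pr (_ e) (_ e)", simplified])
  moreover have "A a j \<le> 2 ^ L a * 4"
    if "2 ^ j * measure \<mu> (clopen_set (L a) (Q a)) \<le> 2" for a j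
  proof -
    have "2 ^ L a * (2 ^ j * measure \<mu> (clopen_set (L a) (Q a))) \<le> 2 ^ L a * 2"
      by (intro mult_left_mono that) simp
    then have "real (A a j) \<le> real (2 ^ L a * 4)"
      unfolding of_nat_mult of_nat_power of_nat_numeral using error[of a j] by linarith
    then show ?thesis by (simp only: of_nat_le_iff)
  qed
  moreover have "2 ^ j * measure \<mu> (clopen_set (L a) (Q a)) \<le> 6" if "A a j \<le> 2 ^ L a * 4" for a j
  proof -
    have "real (A a j) \<le> real (2 ^ L a * 4)" using that by (simp only: of_nat_le_iff)
    then have "2 ^ L a * (2 ^ j * measure \<mu> (clopen_set (L a) (Q a))) \<le> 2 ^ L a * 6"
      unfolding of_nat_mult of_nat_power of_nat_numeral using error[of a j] by linarith
    then show ?thesis by simp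
  qed
  ultimately show ?thesis by (rule that[of "\<lambda>a j. A a j \<le> 2 ^ L a * 4"])
qed

section \<open>A universal Martin-Loef test\<close>

text \<open>
  What the \<open>e\<close>-th c.e. relation has put into its \<open>i\<close>-th open set when only prefixes of length at
  most \<open>s\<close> and witnesses below \<open>s\<close> are considered.  Bounding the prefixes by \<open>s\<close> makes this a clopen
  set of level \<open>s\<close>.
\<close>

definition stage :: "nat \<Rightarrow> nat \<Rightarrow> nat \<Rightarrow> cantor set" where
  "stage e i s =
     clopen_set s (\<lambda>t. \<exists>j<Suc s. \<exists>z<s. universal_ce e i (str_code (word t j)) z)"

lemma mem_stage_iff:
  "X \<in> stage e i s \<longleftrightarrow> (\<exists>j\<le>s. \<exists>z<s. universal_ce e i (str_code (init X j)) z)"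
proof -
  obtain u where u: "u < 2 ^ s" "word u s = init X s"
    using word_surj[of "init X s"] by auto
  have "word t j = init X j" if "word t s = init X s" "j \<le> s" for t j
    using that take_word[of j s t] take_init[of j s X] by simp
  then show ?thesis
    unfolding stage_def mem_clopen_set_iff less_Suc_eq_le using u by metis
qed

lemma stage_mono: "s \<le> s' \<Longrightarrow> stage e i s \<subseteq> stage e i s'"
  unfolding subset_iff mem_stage_iff by (meson less_le_trans order_trans)

lemma UN_stage:
  assumes "\<And>x y. W x y \<longleftrightarrow> (\<exists>z. universal_ce e x y z)"
  shows "(\<Union>s. stage e i s) = (\<Union>\<sigma>\<in>{\<sigma>. W i (str_code \<sigma>)}. cylinder \<sigma>)"
proof (intro set_eqI iffI)
  fix X assume "X \<in> (\<Union>s. stage e i s)"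
  then obtain j where "W i (str_code (init X j))" unfolding assms by (auto simp: mem_stage_iff)
  then show "X \<in> (\<Union>\<sigma>\<in>{\<sigma>. W i (str_code \<sigma>)}. cylinder \<sigma>)"
    by (intro UN_I[of "init X j"]) (simp_all add: mem_cylinder_iff)
next
  fix X assume "X \<in> (\<Union>\<sigma>\<in>{\<sigma>. W i (str_code \<sigma>)}. cylinder \<sigma>)"
  then obtain \<sigma> z where "init X (length \<sigma>) = \<sigma>" "universal_ce e i (str_code \<sigma>) z"
    unfolding assms by (auto simp: mem_cylinder_iff)
  then have "X \<in> stage e i (Suc (length \<sigma> + z))"
    unfolding mem_stage_iff by (intro exI[of _ "length \<sigma>"] exI[of _ z] conjI) auto
  then show "X \<in> (\<Union>s. stage e i s)" by blast
qed

text \<open>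
  Level \<open>i\<close> of the test is the union over \<open>e\<close> of level \<open>i + e + 4\<close> of the \<open>e\<close>-th c.e. family, of
  which only those stages are admitted that pass the approximate test for measure at most
  \<open>6 / 2 ^ (i + e + 4)\<close>.  As the stages increase, the admitted part has measure at most
  \<open>(1/2) ^ (i + e + 1)\<close>, and these bounds add up to \<open>(1/2) ^ i\<close>.  If the \<open>e\<close>-th family is a Martin-Loef test, then its level
  \<open>i + e + 4\<close> has measure at most \<open>(1/2) ^ (i + e + 4)\<close>, all stages pass, and nothing is lost.
\<close>

theorem universal_martin_loef_test_exists:
  fixes \<mu> :: "cantor measure"
  assumes \<mu>: "prob_space \<mu>" "sets \<mu> = sets borel" "computable_measure \<mu>"
  shows "\<exists>U. universal_martin_loef_test \<mu> U"
proof -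
  interpret prob_space \<mu> by fact
  define Q where "Q a t \<longleftrightarrow> (\<exists>j<Suc (psnd (psnd a)). \<exists>z<psnd (psnd a).
    universal_ce (pfst a) (pfst (psnd a)) (str_code (word t j)) z)" for a t
  have stage: "stage e i s = clopen_set (psnd (psnd (pr e (pr i s)))) (Q (pr e (pr i s)))"
    for e i s by (simp add: stage_def Q_def[abs_def])
  have Q: "decidable (\<lambda>e. Q (pfst e) (psnd e))"
    unfolding Q_def
    by (intro computability_intros decidable_universal_ce computable1_str_code_word)
  have L: "computable1 (\<lambda>a. psnd (psnd a))" by (intro computability_intros)
  obtain small where small: "decidable (\<lambda>e. small (pfst e) (psnd e))"
    "\<And>a j. 2 ^ j * measure \<mu> (clopen_set (psnd (psnd a)) (Q a)) \<le> 2 \<Longrightarrow> small a j"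
    "\<And>a j. small a j \<Longrightarrow> 2 ^ j * measure \<mu> (clopen_set (psnd (psnd a)) (Q a)) \<le> 6"
    by (rule decide_small_measure[OF \<mu> L Q]) (rule that, assumption+)
  have small1: "2 ^ j * measure \<mu> (stage e i s) \<le> 2 \<Longrightarrow> small (pr e (pr i s)) j" for e i s j
    unfolding stage by (rule small(2))
  have small2: "small (pr e (pr i s)) j \<Longrightarrow> 2 ^ j * measure \<mu> (stage e i s) \<le> 6" for e i s j
    unfolding stage by (rule small(3))
  have open_stage: "open (stage e i s)" for e i s
    unfolding stage_def by (rule open_clopen_set)
  define good where "good i e = {s. small (pr e (pr (i + e + 4) s)) (i + e + 4)}" for i e
  define V where "V i e = (\<Union>s\<in>good i e. stage e (i + e + 4) s)" for i e
  define U where "U i = (\<Union>e. V i e)" for i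
  have V_sets: "V i e \<in> sets \<mu>" for i e
    unfolding V_def \<mu>(2) by (intro borel_open open_UN ballI open_stage)
  have measure_V: "measure \<mu> (V i e) \<le> (1/2) ^ (i + 1) * (1/2) ^ e" for i e
  proof -
    \<comment> \<open>the admitted stages need not be an initial segment, so limits are taken along their partial unions\<close>
    define C where "C n = (\<Union>s\<in>good i e \<inter> {..n}. stage e (i + e + 4) s)" for n
    have "V i e = (\<Union>n. C n)" unfolding V_def C_def by auto
    moreover have "(\<lambda>n. measure \<mu> (C n)) \<longlonglongrightarrow> measure \<mu> (\<Union>n. C n)"
    proof (rule finite_Lim_measure_incseq)
      show "range C \<subseteq> sets \<mu>"
        unfolding C_def \<mu>(2) by (auto intro!: borel_open open_stage)
      show "incseq C" unfolding C_def by (intro incseq_SucI) auto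
    qed
    moreover have "measure \<mu> (C n) \<le> (1/2) ^ (i + 1) * (1/2) ^ e" for n
    proof (cases "good i e \<inter> {..n} = {}")
      case True
      then show ?thesis by (simp add: C_def)
    next
      case False
      define s where "s = Max (good i e \<inter> {..n})"
      have s: "s \<in> good i e" "\<And>s'. s' \<in> good i e \<inter> {..n} \<Longrightarrow> s' \<le> s"
        using Max_in[of "good i e \<inter> {..n}"] False unfolding s_def by auto
      then have "C n \<subseteq> stage e (i + e + 4) s"
        unfolding C_def using stage_mono by blast
      then have "measure \<mu> (C n) \<le> measure \<mu> (stage e (i + e + 4) s)"
        by (intro finite_measure_mono) (simp_all add: \<mu>(2) open_stage)
      then have "2 ^ (i + e + 1) * measure \<mu> (C n) \<le> 2 ^ (i + e + 1) * measure \<mu> (stage e (i + e + 4) s)"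
        by (intro mult_left_mono) auto
      moreover have "2 ^ (i + e + 4) * measure \<mu> (stage e (i + e + 4) s) \<le> 6"
        using s(1) unfolding good_def by (intro small2) simp
      moreover have "2 ^ (i + e + 4) = (8 :: real) * 2 ^ (i + e + 1)" by (simp add: power_add)
      ultimately have "2 ^ (i + e + 1) * measure \<mu> (C n) \<le> 1"
        by (simp only: mult.assoc)
      then show ?thesis by (simp add: power_add power_divide field_simps)
    qed
    ultimately show ?thesis using LIMSEQ_le_const2 by metis
  qed
  have measure_U: "measure \<mu> (U i) \<le> (1/2) ^ i" for i
  proof -
    have sums: "(\<lambda>e. (1/2) ^ (i + 1) * (1/2) ^ e :: real) sums ((1/2) ^ (i + 1) * 2)"
      using sums_mult[OF geometric_sums[of "1/2 :: real"], of "(1/2) ^ (i + 1)"] by simp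
    have summable: "summable (\<lambda>e. measure \<mu> (V i e))"
      by (rule summable_comparison_test'[OF sums_summable[OF sums]]) (use measure_V in auto)
    have "measure \<mu> (U i) \<le> (\<Sum>e. measure \<mu> (V i e))"
      unfolding U_def using summable V_sets by (intro finite_measure_subadditive_countably) auto
    also have "\<dots> \<le> (\<Sum>e. (1/2) ^ (i + 1) * (1/2) ^ e)"
      by (intro suminf_le summable sums_summable[OF sums] measure_V)
    also have "\<dots> = (1/2) ^ i" using sums_unique[OF sums] by simp
    finally show ?thesis .
  qed
  \<comment> \<open>\<open>z\<close> packs the index, the stage and the index of the string\<close>
  define P where "P i c z \<longleftrightarrow> (let e = pfst z; s = pfst (psnd z); t = psnd (psnd z);
      a = pr e (pr (i + e + 4) s) in
    t < 2 ^ s \<and> Q a t \<and> small a (i + e + 4) \<and> c = str_code (word t s))" for i c z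
  have "decidable (\<lambda>e. P (pfst e) (pfst (psnd e)) (psnd (psnd e)))"
    unfolding P_def Let_def
    by (intro computability_intros computable1_str_code_word
        decidable_comp[OF Q, of "\<lambda>e. pr (_ e) (_ e)", simplified]
        decidable_comp[OF small(1), of "\<lambda>e. pr (_ e) (_ e)", simplified])
  then have "ce2 (\<lambda>i c. \<exists>z. P i c z)" by (rule ce2I)
  moreover have "U i = (\<Union>\<sigma>\<in>{\<sigma>. \<exists>z. P i (str_code \<sigma>) z}. cylinder \<sigma>)" for i
  proof (intro set_eqI iffI)
    fix X assume "X \<in> U i"
    then obtain e s where s: "small (pr e (pr (i + e + 4) s)) (i + e + 4)"
      and "X \<in> stage e (i + e + 4) s"
      unfolding U_def V_def good_def by blast
    then obtain t where t: "t < 2 ^ s" "Q (pr e (pr (i + e + 4) s)) t" "word t s = init X s"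
      unfolding stage by (auto simp: mem_clopen_set_iff)
    have "P i (str_code (word t s)) (pr e (pr s t))"
      using s t by (simp add: P_def)
    moreover have "X \<in> cylinder (word t s)" by (simp add: mem_cylinder_iff t)
    ultimately show "X \<in> (\<Union>\<sigma>\<in>{\<sigma>. \<exists>z. P i (str_code \<sigma>) z}. cylinder \<sigma>)" by blast
  next
    fix X assume "X \<in> (\<Union>\<sigma>\<in>{\<sigma>. \<exists>z. P i (str_code \<sigma>) z}. cylinder \<sigma>)"
    then obtain \<sigma> z where z: "P i (str_code \<sigma>) z" and X: "init X (length \<sigma>) = \<sigma>"
      by (auto simp: mem_cylinder_iff)
    define e s t where "e = pfst z" and "s = pfst (psnd z)" and "t = psnd (psnd z)"
    have *: "t < 2 ^ s" "Q (pr e (pr (i + e + 4) s)) t"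
      "small (pr e (pr (i + e + 4) s)) (i + e + 4)" "\<sigma> = word t s"
      using z injD[OF inj_str_code] by (auto simp: P_def Let_def e_def s_def t_def)
    then have "X \<in> stage e (i + e + 4) s"
      unfolding stage using X by (auto simp: mem_clopen_set_iff)
    then show "X \<in> U i" unfolding U_def V_def good_def using * by blast
  qed
  ultimately have "martin_loef_test \<mu> U"
    unfolding martin_loef_test_def uniformly_Sigma01_def using measure_U by blast
  moreover have "(\<Inter>i. T i) \<subseteq> (\<Inter>i. U i)" if T: "martin_loef_test \<mu> T" for T
  proof
    fix X assume X: "X \<in> (\<Inter>i. T i)"
    obtain W where W: "ce2 W" "\<And>i. T i = (\<Union>\<sigma>\<in>{\<sigma>. W i (str_code \<sigma>)}. cylinder \<sigma>)"
      using T unfolding martin_loef_test_def uniformly_Sigma01_def by blast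
    obtain e where e: "\<And>x y. W x y \<longleftrightarrow> (\<exists>z. universal_ce e x y z)"
      by (rule universal_ce_enumerates[OF W(1)]) (rule that, assumption)
    have T_stage: "T j = (\<Union>s. stage e j s)" for j
      unfolding W(2) by (rule UN_stage[OF e, symmetric])
    have "X \<in> U i" for i
    proof -
      let ?j = "i + e + 4"
      obtain s where s: "X \<in> stage e ?j s" using X T_stage[of ?j] by blast
      have "measure \<mu> (stage e ?j s) \<le> measure \<mu> (T ?j)"
        unfolding T_stage
        by (intro finite_measure_mono) (auto simp: \<mu>(2) open_stage)
      also have "\<dots> \<le> (1/2) ^ ?j" using T unfolding martin_loef_test_def by blast
      finally have "2 ^ ?j * measure \<mu> (stage e ?j s) \<le> 2 ^ ?j * (1/2) ^ ?j"
        by (intro mult_left_mono) auto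
      also have "\<dots> = 1" by (simp only: power_mult_distrib[symmetric]) simp
      finally have "small (pr e (pr ?j s)) ?j" by (intro small1) simp
      then show ?thesis using s unfolding U_def V_def good_def by blast
    qed
    then show "X \<in> (\<Inter>i. U i)" by blast
  qed
  ultimately show ?thesis unfolding universal_martin_loef_test_def by blast
qed

section \<open>Computably perfect classes and trivial measures\<close>

lemma cylinder_antimono:
  assumes "prefix \<sigma> \<tau>" shows "cylinder \<tau> \<subseteq> cylinder \<sigma>"
proof
  fix X assume "X \<in> cylinder \<tau>"
  then have "\<tau> = init X (length \<tau>)" by (simp add: mem_cylinder_iff)
  then have "take (length \<sigma>) \<tau> = init X (length \<sigma>)"
    using take_init[OF prefix_length_le[OF assms]] by metis
  then show "X \<in> cylinder \<sigma>" using assms by (auto simp: mem_cylinder_iff prefix_def)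
qed

lemma halving_extension:
  fixes \<mu> :: "cantor measure"
  assumes \<mu>: "prob_space \<mu>" "sets \<mu> = sets borel"
    and "prefix \<sigma> \<tau>1" "prefix \<sigma> \<tau>2" "\<tau>1 \<parallel> \<tau>2"
  shows "measure \<mu> (cylinder \<tau>1) \<le> measure \<mu> (cylinder \<sigma>) / 2 \<or>
    measure \<mu> (cylinder \<tau>2) \<le> measure \<mu> (cylinder \<sigma>) / 2"
proof -
  interpret prob_space \<mu> by fact
  have sets: "cylinder \<tau> \<in> sets \<mu>" for \<tau> by (simp add: \<mu>(2) open_cylinder)
  have prefix: "prefix \<sigma> \<tau>" if "X \<in> cylinder \<sigma>" "X \<in> cylinder \<tau>" "length \<sigma> \<le> length \<tau>" for X \<sigma> \<tau>
    using that take_init[of "length \<sigma>" "length \<tau>" X]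
    by (metis mem_cylinder_iff take_is_prefix)
  have "cylinder \<tau>1 \<inter> cylinder \<tau>2 = {}"
  proof (rule equals0I)
    fix X assume "X \<in> cylinder \<tau>1 \<inter> cylinder \<tau>2"
    then have "prefix \<tau>1 \<tau>2 \<or> prefix \<tau>2 \<tau>1"
      using prefix by (metis IntE nat_le_linear)
    then show False using assms(5) by blast
  qed
  then have "measure \<mu> (cylinder \<tau>1) + measure \<mu> (cylinder \<tau>2) = measure \<mu> (cylinder \<tau>1 \<union> cylinder \<tau>2)"
    by (simp add: finite_measure_Union sets)
  also have "\<dots> \<le> measure \<mu> (cylinder \<sigma>)"
    using cylinder_antimono[OF assms(3)] cylinder_antimono[OF assms(4)]
    by (intro finite_measure_mono sets) simp
  finally show ?thesis by linarith
qed

text \<open>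
  The strings \<open>\<sigma> n\<close> are chosen recursively by \<open>halving_extension\<close>.  Membership of their limit in the
  closure of \<open>D\<close> is expressed by extendibility of all its prefixes.
\<close>

lemma light_path_in_closure:
  fixes \<mu> :: "cantor measure" and f :: "nat \<Rightarrow> nat"
  assumes \<mu>: "prob_space \<mu>" "sets \<mu> = sets borel"
    and D: "D \<noteq> {}" and f: "strict_mono f"
    and split: "\<And>n \<sigma>. \<sigma> \<in> Ext D \<Longrightarrow> length \<sigma> = f n \<Longrightarrow> \<exists>\<tau>1\<in>Ext D. \<exists>\<tau>2\<in>Ext D.
      prefix \<sigma> \<tau>1 \<and> prefix \<sigma> \<tau>2 \<and> \<tau>1 \<parallel> \<tau>2 \<and> length \<tau>1 = f (n + 1) \<and> length \<tau>2 = f (n + 1)"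
  obtains X where "\<And>n. init X n \<in> Ext D" "\<And>n. measure \<mu> (cylinder (init X (f n))) \<le> (1/2) ^ n"
proof -
  interpret prob_space \<mu> by fact
  obtain Y where "Y \<in> D" using D by blast
  then have Y: "init Y (f 0) \<in> Ext D" by (auto simp: Ext_def initial_segment_iff)
  have "\<exists>\<sigma>. \<forall>n. (\<sigma> n \<in> Ext D \<and> length (\<sigma> n) = f n \<and> measure \<mu> (cylinder (\<sigma> n)) \<le> (1/2) ^ n) \<and>
    prefix (\<sigma> n) (\<sigma> (Suc n))"
  proof (rule dependent_nat_choice)
    show "\<exists>\<sigma>. \<sigma> \<in> Ext D \<and> length \<sigma> = f 0 \<and> measure \<mu> (cylinder \<sigma>) \<le> (1/2) ^ 0"
      using Y by (intro exI[of _ "init Y (f 0)"]) simp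
    fix \<sigma> n
    assume \<sigma>: "\<sigma> \<in> Ext D \<and> length \<sigma> = f n \<and> measure \<mu> (cylinder \<sigma>) \<le> (1/2) ^ n"
    then obtain \<tau>1 \<tau>2 where \<tau>: "\<tau>1 \<in> Ext D" "\<tau>2 \<in> Ext D" "prefix \<sigma> \<tau>1" "prefix \<sigma> \<tau>2" "\<tau>1 \<parallel> \<tau>2"
      "length \<tau>1 = f (Suc n)" "length \<tau>2 = f (Suc n)"
      using split[of \<sigma> n] by auto
    have "measure \<mu> (cylinder \<sigma>) / 2 \<le> (1/2) ^ Suc n" using \<sigma> by simp
    then show "\<exists>\<tau>. (\<tau> \<in> Ext D \<and> length \<tau> = f (Suc n) \<and> measure \<mu> (cylinder \<tau>) \<le> (1/2) ^ Suc n) \<and>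
      prefix \<sigma> \<tau>"
      using halving_extension[OF \<mu> \<tau>(3-5)] \<tau> by (meson order_trans)
  qed
  then obtain \<sigma> where \<sigma>: "\<And>n. \<sigma> n \<in> Ext D" "\<And>n. length (\<sigma> n) = f n"
    "\<And>n. measure \<mu> (cylinder (\<sigma> n)) \<le> (1/2) ^ n" "\<And>n. prefix (\<sigma> n) (\<sigma> (Suc n))"
    by blast
  define X where "X i = \<sigma> (Suc i) ! i" for i
  have mono: "prefix (\<sigma> m) (\<sigma> n)" if "m \<le> n" for m n
    using that by (induction rule: dec_induct) (use \<sigma>(4) prefix_order.trans in blast)+
  have nth: "X i = \<sigma> n ! i" if "i < f n" for i n
  proof -
    have "i < f (Suc i)" using strict_mono_imp_increasing[OF f, of "Suc i"] by simp
    then show ?thesis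
      using mono[of n "Suc i"] mono[of "Suc i" n] that \<sigma>(2) nat_le_linear[of n "Suc i"]
      unfolding X_def by (auto simp: prefix_def nth_append)
  qed
  have init: "init X (f n) = \<sigma> n" for n
    by (rule nth_equalityI) (auto simp: \<sigma>(2) init_def nth)
  have "init X n \<in> Ext D" for n
  proof -
    obtain Z where Z: "Z \<in> D" "\<sigma> n \<prec> Z" using \<sigma>(1)[of n] by (auto simp: Ext_def)
    have "n \<le> f n" using f by (rule strict_mono_imp_increasing)
    then have "init X n = init Z n"
      using Z(2) init[of n] take_init[of n "f n"] by (metis initial_segment_iff \<sigma>(2))
    then show ?thesis using Z(1) by (auto simp: Ext_def initial_segment_iff)
  qed
  then show ?thesis using \<sigma>(3) by (intro that[of X]) (simp_all add: init)
qed

text \<open>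
  An atom belongs to only finitely many of the sets, since \<open>b\<close> eventually drops below its mass.  The
  limit superior of the sets is therefore disjoint from the atoms and, as \<open>\<mu>\<close> is trivial, null.
\<close>

lemma light_sets_vanish:
  fixes \<mu> :: "cantor measure"
  assumes \<mu>: "prob_space \<mu>" "sets \<mu> = sets borel" "trivial_measure \<mu>"
    and B: "\<And>n. B n \<in> sets \<mu>"
    and light: "\<And>n X. X \<in> B n \<Longrightarrow> measure \<mu> {X} \<le> b n" and b: "b \<longlonglongrightarrow> 0"
  shows "(\<lambda>n. measure \<mu> (B n)) \<longlonglongrightarrow> 0"
proof -
  interpret prob_space \<mu> by fact
  have Atoms: "Atoms \<mu> \<in> sets \<mu>" "measure \<mu> (Atoms \<mu>) = 1"
    using \<mu>(3) measure_notin_sets[of "Atoms \<mu>" \<mu>] unfolding trivial_measure_def by auto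
  define C where "C n = (\<Union>k\<in>{n..}. B k)" for n
  have C: "C n \<in> sets \<mu>" for n unfolding C_def using B by auto
  have "(\<Inter>n. C n) \<inter> Atoms \<mu> = {}"
  proof (rule equals0I)
    fix X assume X: "X \<in> (\<Inter>n. C n) \<inter> Atoms \<mu>"
    then have "0 < measure \<mu> {X}" by (simp add: Atoms_def)
    then have "eventually (\<lambda>n. b n < measure \<mu> {X}) sequentially"
      by (rule order_tendstoD(2)[OF b])
    then obtain N where N: "\<And>n. n \<ge> N \<Longrightarrow> b n < measure \<mu> {X}"
      unfolding eventually_sequentially by blast
    obtain k where "k \<ge> N" "X \<in> B k" using X unfolding C_def by blast
    then show False using light[of X k] N[of k] by simp
  qed
  then have "measure \<mu> ((\<Inter>n. C n) \<union> Atoms \<mu>) = measure \<mu> (\<Inter>n. C n) + measure \<mu> (Atoms \<mu>)"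
    using C Atoms by (intro finite_measure_Union) auto
  then have "measure \<mu> (\<Inter>n. C n) = 0"
    using Atoms(2) prob_le_1[of "(\<Inter>n. C n) \<union> Atoms \<mu>"] measure_nonneg[of \<mu> "\<Inter>n. C n"] by linarith
  moreover have "(\<lambda>n. measure \<mu> (C n)) \<longlonglongrightarrow> measure \<mu> (\<Inter>n. C n)"
  proof (rule finite_Lim_measure_decseq)
    show "range C \<subseteq> sets \<mu>" using C by auto
    show "decseq C" unfolding C_def by (intro decseq_SucI UN_mono) auto
  qed
  ultimately have "(\<lambda>n. measure \<mu> (C n)) \<longlonglongrightarrow> 0" by simp
  moreover have "measure \<mu> (B n) \<le> measure \<mu> (C n)" for n
    by (intro finite_measure_mono C) (auto simp: C_def)
  ultimately show ?thesis
    using tendsto_sandwich[of "\<lambda>n. 0" "\<lambda>n. measure \<mu> (B n)" sequentially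
        "\<lambda>n. measure \<mu> (C n)" 0] by simp
qed

text \<open>
  The sequences whose prefix of length \<open>f n\<close> looks light at precision \<open>n\<close> form a clopen set \<open>B n\<close> that
  contains \<open>X\<close> and in which each point has mass at most \<open>5 * (1/2) ^ n\<close>.  By \<open>light_sets_vanish\<close> the
  measures of these sets tend to \<open>0\<close>.  No rate of convergence is known in advance, but \<open>\<mu>\<close> being
  computable, a set \<open>B n\<close> of the required measure can be searched for.
\<close>

lemma light_path_caught:
  fixes \<mu> :: "cantor measure"
  assumes \<mu>: "prob_space \<mu>" "sets \<mu> = sets borel" "computable_measure \<mu>" "trivial_measure \<mu>"
    and f: "computable1 f"
    and X: "\<And>n. measure \<mu> (cylinder (init X (f n))) \<le> (1/2) ^ n"
  obtains V where "martin_loef_test \<mu> V" "X \<in> (\<Inter>k. V k)"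
proof -
  interpret prob_space \<mu> by fact
  obtain m where m: "computable2 m"
    "\<And>\<sigma> n. \<bar>2 ^ n * measure \<mu> (cylinder \<sigma>) - real (m (str_code \<sigma>) n)\<bar> \<le> 2"
    using natural_approximation[OF \<mu>(3)[unfolded computable_measure_def]] by (metis measure_nonneg)
  define Q where "Q n t \<longleftrightarrow> m (str_code (word t (f n))) n \<le> 3" for n t
  define B where "B n = clopen_set (f n) (Q n)" for n
  have mem_B: "Y \<in> B n \<longleftrightarrow> m (str_code (init Y (f n))) n \<le> 3" for Y n
    using word_surj[of "init Y (f n)"] by (auto simp: B_def mem_clopen_set_iff Q_def)
  have scale: "2 ^ n * (1/2) ^ n = (1 :: real)" for n by (simp flip: power_mult_distrib)
  have X_B: "X \<in> B n" for n
  proof -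
    have "2 ^ n * measure \<mu> (cylinder (init X (f n))) \<le> 2 ^ n * (1/2) ^ n"
      by (intro mult_left_mono X) simp
    then have "real (m (str_code (init X (f n))) n) \<le> 3"
      using m(2)[of n "init X (f n)"] unfolding scale by linarith
    then show ?thesis unfolding mem_B by simp
  qed
  have B_sets: "B n \<in> sets \<mu>" for n
    unfolding B_def \<mu>(2) by (intro borel_open open_clopen_set)
  have B_light: "measure \<mu> {Y} \<le> 5 * (1/2) ^ n" if "Y \<in> B n" for Y n
  proof -
    have "real (m (str_code (init Y (f n))) n) \<le> 3" using that unfolding mem_B by simp
    then have "2 ^ n * measure \<mu> (cylinder (init Y (f n))) \<le> 5"
      using m(2)[of n "init Y (f n)"] by linarith
    moreover have "measure \<mu> {Y} \<le> measure \<mu> (cylinder (init Y (f n)))"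
      by (intro finite_measure_mono) (auto simp: \<mu>(2) open_cylinder mem_cylinder_iff)
    ultimately have "2 ^ n * measure \<mu> {Y} \<le> 5"
      by (meson mult_left_mono order_trans zero_le_numeral zero_le_power)
    then show ?thesis by (simp add: power_divide field_simps)
  qed
  have "(\<lambda>n. 5 * (1/2) ^ n :: real) \<longlonglongrightarrow> 5 * 0"
    by (intro tendsto_mult tendsto_const LIMSEQ_power_zero) simp
  then have B_vanish: "(\<lambda>n. measure \<mu> (B n)) \<longlonglongrightarrow> 0"
    by (intro light_sets_vanish[OF \<mu>(1,2,4) B_sets B_light]) simp_all
  have Q: "decidable (\<lambda>e. Q (pfst e) (psnd e))"
    unfolding Q_def
    by (intro computability_intros computable1_comp2[OF m(1)] computable1_str_code_word
        computable1_comp[OF f])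
  obtain small where small: "decidable (\<lambda>e. small (pfst e) (psnd e))"
    "\<And>n j. 2 ^ j * measure \<mu> (clopen_set (f n) (Q n)) \<le> 2 \<Longrightarrow> small n j"
    "\<And>n j. small n j \<Longrightarrow> 2 ^ j * measure \<mu> (clopen_set (f n) (Q n)) \<le> 6"
    by (rule decide_small_measure[OF \<mu>(1-3) f Q]) (rule that, assumption+)
  note small = small[folded B_def]
  have ex: "\<exists>n. small n (k + 3)" for k
  proof -
    have "eventually (\<lambda>n. measure \<mu> (B n) < 1 / 2 ^ (k + 3)) sequentially"
      by (rule order_tendstoD(2)[OF B_vanish]) simp
    then obtain n where "measure \<mu> (B n) < 1 / 2 ^ (k + 3)"
      using eventually_happens'[OF sequentially_bot] by blast
    then have "2 ^ (k + 3) * measure \<mu> (B n) \<le> 1" by (simp add: field_simps)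
    then show ?thesis using small(2)[of "k + 3" n] by auto
  qed
  define g where "g k = (LEAST n. small n (k + 3))" for k
  have g_small: "small (g k) (k + 3)" for k
    unfolding g_def using ex by (rule LeastI_ex)
  have g: "computable1 g"
    unfolding g_def
    by (intro computable1_Least ex computability_intros
        decidable_comp[OF small(1), of "\<lambda>e. pr (_ e) (_ e)", simplified])
  define V where "V k = B (g k)" for k
  have "measure \<mu> (V k) \<le> (1/2) ^ k" for k
  proof -
    \<comment> \<open>three extra bits suffice because \<open>6 \<le> 2 ^ 3\<close>\<close>
    have "2 ^ (k + 3) * measure \<mu> (V k) \<le> 6" unfolding V_def by (intro small(3) g_small)
    then have "8 * (2 ^ k * measure \<mu> (V k)) \<le> 6" by (simp add: power_add mult_ac)
    then have "2 ^ k * measure \<mu> (V k) \<le> 1" by linarith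
    then show ?thesis by (simp add: power_divide field_simps)
  qed
  moreover have "uniformly_Sigma01 V"
  proof -
    have "ce2 (\<lambda>k c. \<exists>t. t < 2 ^ f (g k) \<and> Q (g k) t \<and> c = str_code (word t (f (g k))))"
      by (intro ce2I computability_intros computable1_str_code_word computable1_comp[OF f]
          computable1_comp[OF g] decidable_comp[OF Q, of "\<lambda>e. pr (_ e) (_ e)", simplified])
    moreover have "V k = (\<Union>\<sigma>\<in>{\<sigma>. \<exists>t. t < 2 ^ f (g k) \<and> Q (g k) t \<and>
        str_code \<sigma> = str_code (word t (f (g k)))}. cylinder \<sigma>)" for k
      unfolding V_def B_def clopen_set_def using injD[OF inj_str_code] by blast
    ultimately show ?thesis unfolding uniformly_Sigma01_def by blast
  qed
  ultimately have "martin_loef_test \<mu> V" unfolding martin_loef_test_def by blast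
  then show ?thesis using X_B by (intro that[of V]) (simp_all add: V_def)
qed

text \<open>
  The light path lies in \<open>U i\<close> by universality.  As \<open>U i\<close> is a union of cylinders, one of them contains
  the path, and it meets \<open>D\<close> because the path is in the closure of \<open>D\<close>.
\<close>

theorem diminutive_complement:
  fixes \<mu> :: "cantor measure"
  assumes \<mu>: "prob_space \<mu>" "sets \<mu> = sets borel" "computable_measure \<mu>" "trivial_measure \<mu>"
    and U: "universal_martin_loef_test \<mu> U"
  shows "diminutive (- U i)"
  unfolding diminutive_def
proof (intro notI)
  assume "\<exists>D. D \<subseteq> - U i \<and> computably_perfect D"
  then obtain D where D: "D \<subseteq> - U i" "computably_perfect D" by blast
  then obtain f where f: "computable1 f" "strict_mono f" and "D \<noteq> {}"
    and "\<forall>n. \<forall>\<sigma>\<in>Ext D. length \<sigma> = f n \<longrightarrow>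
         (\<exists>\<tau>1\<in>Ext D. \<exists>\<tau>2\<in>Ext D. prefix \<sigma> \<tau>1 \<and> prefix \<sigma> \<tau>2 \<and> \<tau>1 \<parallel> \<tau>2 \<and>
            length \<tau>1 = f (n + 1) \<and> length \<tau>2 = f (n + 1))"
    unfolding computably_perfect_def by blast
  then obtain X where X: "\<And>n. init X n \<in> Ext D"
    "\<And>n. measure \<mu> (cylinder (init X (f n))) \<le> (1/2) ^ n"
    using light_path_in_closure[OF \<mu>(1,2) \<open>D \<noteq> {}\<close> f(2)] by blast
  obtain V where "martin_loef_test \<mu> V" "X \<in> (\<Inter>k. V k)"
    by (rule light_path_caught[OF \<mu> f(1) X(2)]) (rule that, assumption+)
  then have "X \<in> U i" using U unfolding universal_martin_loef_test_def by blast
  moreover have "martin_loef_test \<mu> U"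
    using U unfolding universal_martin_loef_test_def by blast
  then obtain W where "\<And>i. U i = (\<Union>\<sigma>\<in>{\<sigma>. W i (str_code \<sigma>)}. cylinder \<sigma>)"
    unfolding martin_loef_test_def uniformly_Sigma01_def by blast
  ultimately obtain \<sigma> where \<sigma>: "X \<in> cylinder \<sigma>" "cylinder \<sigma> \<subseteq> U i" by blast
  then have "\<sigma> \<in> Ext D" using X(1)[of "length \<sigma>"] by (simp add: mem_cylinder_iff)
  then obtain Y where "Y \<in> D" "Y \<in> cylinder \<sigma>" by (auto simp: Ext_def cylinder_def)
  then show False using D(1) \<sigma>(2) by blast
qed

theorem proposition6p7:
  fixes \<mu> :: "(nat \<Rightarrow> bool) measure"
  assumes "prob_space \<mu>" and "sets \<mu> = sets borel"
    and "computable_measure \<mu>" and "trivial_measure \<mu>"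
  shows "diminutive_measure \<mu>"
  unfolding diminutive_measure_def
  using universal_martin_loef_test_exists[OF assms(1-3)] diminutive_complement[OF assms] by blast

end
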